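(* Let $f$ be a pseudo-polynomial. There exist an exponent $\eta>0$ and a constant $C>0$, both depending only on $f$, such that for every real number $\xi$ and every sufficiently large $N\in\mathbb{N}$, \[\min_{1\le n\le N}\lVert\xi\lfloor f(n)\rfloor\rVert\le C N^{-\eta}.\]
   Context: A pseudo-polynomial is a function $f(x)=\alpha_1x^{\theta_1}+\cdots+\alpha_dx^{\theta_d}$ where $\alpha_1,\dots,\alpha_d,\theta_1,\dots,\theta_d$ are positive reals with $1\le\theta_1<\cdots<\theta_d$ and at least one $\theta_j\notin\mathbb{Z}$. $\lVert x\rVert$ denotes the distance from $x$ to the nearest integer, and $\lfloor\cdot\rfloor$ the floor function. *)

theory Defs
  imports "HOL-Analysis.Analysis"
begin

definition dist_nint :: "real \<Rightarrow> real" where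
  "dist_nint x = (INF k\<in>(\<int>::real set). \<bar>x - k\<bar>)"

definition pseudo_poly :: "nat \<Rightarrow> (nat \<Rightarrow> real) \<Rightarrow> (nat \<Rightarrow> real) \<Rightarrow> bool" where
  "pseudo_poly d \<alpha> \<theta> \<longleftrightarrow> d \<ge> 1 \<and> (\<forall>i\<in>{1..d}. \<alpha> i > 0) \<and> \<theta> 1 \<ge> 1 \<and>
     (\<forall>i\<in>{1..d}. \<forall>j\<in>{1..d}. i < j \<longrightarrow> \<theta> i < \<theta> j) \<and> (\<exists>j\<in>{1..d}. \<theta> j \<notin> \<int>)"

definition pp_eval :: "nat \<Rightarrow> (nat \<Rightarrow> real) \<Rightarrow> (nat \<Rightarrow> real) \<Rightarrow> real \<Rightarrow> real" where
  "pp_eval d \<alpha> \<theta> x = (\<Sum>i=1..d. \<alpha> i * x powr \<theta> i)"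

end

theory Submission
  imports Defs "HOL-Real_Asymp.Real_Asymp"
begin

text \<open>
  Let \<open>f\<close> be the pseudo-polynomial and \<open>t\<close> its largest non-integral exponent. On short blocks, \<open>f\<close>
  agrees up to a small error with its Taylor polynomial of a fixed degree \<open>k > 2 \<theta>\<^sub>d\<close>, whose top
  coefficient is governed by \<open>x powr (t - k)\<close> because the integral exponents do not contribute.
  Weyl differencing then saves a power of \<open>N\<close> in \<open>\<Sum>n=N..<2N. e(\<beta> f(n))\<close>, uniformly for
  \<open>N powr (- s) \<le> \<bar>\<beta>\<bar> \<le> N powr s\<close>. We may take \<open>0 \<le> \<xi> \<le> 1\<close>. If no \<open>a + b \<xi>\<close> with \<open>b\<close> at most a
  small power of \<open>N\<close> is tiny, all the frequencies \<open>a + b \<xi>\<close> lie in that range, so \<open>(f(n), \<xi> f(n))\<close>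
  comes close to \<open>(0+, 0)\<close> modulo 1 and \<open>\<xi> \<lfloor>f(n)\<rfloor>\<close> is close to an integer. Otherwise \<open>\<xi>\<close> is
  extremely close to a fraction with small denominator \<open>b\<close>, and it suffices to find a much smaller
  \<open>n\<close> such that \<open>b\<close> divides \<open>\<lfloor>f(n)\<rfloor>\<close>, which again follows from the bound on exponential sums.
\<close>

section \<open>Exponential sums and Weyl differencing\<close>

text \<open>Jordan's inequality: sine is concave on \<open>[0, pi]\<close>, so it lies above its
  chord from \<open>0\<close> to \<open>pi / 2\<close>. It bounds geometric sums and later turns a
  small sine into a small distance to an integer.\<close>

lemma sin_pi_ge:
  fixes u :: real
  assumes "\<bar>u\<bar> \<le> 1 / 2"
  shows "2 * \<bar>u\<bar> \<le> \<bar>sin (pi * u)\<bar>"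
proof -
  have conv: "convex_on {0..pi} (\<lambda>x. - sin x :: real)"
  proof (rule f''_ge0_imp_convex)
    show "((\<lambda>x. - sin x :: real) has_real_derivative - cos x) (at x)" for x
      by (auto intro!: derivative_eq_intros)
    show "((\<lambda>x. - cos x :: real) has_real_derivative sin x) (at x)" for x
      by (auto intro!: derivative_eq_intros)
    show "0 \<le> sin x" if "x \<in> {0..pi}" for x :: real
      using that by (auto intro: sin_ge_zero)
  qed auto
  have pos: "2 * v \<le> sin (pi * v)" if "0 \<le> v" "v \<le> 1 / 2" for v :: real
    using convex_onD[OF conv, of "2 * v" 0 "pi / 2"] that by (simp add: mult_ac)
  show ?thesis
  proof (cases "u \<ge> 0")
    case True
    then show ?thesis using pos[of u] assms by auto
  next
    case False
    then show ?thesis using pos[of "- u"] assms by auto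
  qed
qed

section \<open>The additive character of the reals modulo 1\<close>

definition ee :: "real \<Rightarrow> complex" where
  "ee x = cis (2 * pi * x)"

lemma norm_ee [simp]: "norm (ee x) = 1"
  by (simp add: ee_def)

lemma ee_0 [simp]: "ee 0 = 1"
  by (simp add: ee_def)

lemma ee_add: "ee (x + y) = ee x * ee y"
  by (simp add: ee_def cis_mult algebra_simps)

lemma cnj_ee: "cnj (ee x) = ee (- x)"
  by (simp add: ee_def cis_cnj)

lemma ee_power: "ee x ^ n = ee (real n * x)"
  by (induction n) (simp_all add: distrib_right ee_add)

lemma norm_one_minus_ee: "norm (1 - ee x) = 2 * \<bar>sin (pi * x)\<bar>"
proof -
  have "(norm (1 - ee x))\<^sup>2 = (1 - cos (2 * (pi * x)))\<^sup>2 + (sin (2 * (pi * x)))\<^sup>2"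
    by (simp add: ee_def cmod_power2 mult.assoc)
  also have "\<dots> = 2 - 2 * cos (2 * (pi * x))"
    using sin_cos_squared_add[of "2 * (pi * x)"] by (simp add: power2_diff)
  also have "\<dots> = (2 * \<bar>sin (pi * x)\<bar>)\<^sup>2"
    by (subst cos_double_sin) (simp add: power_mult_distrib)
  finally show ?thesis
    by (subst (asm) power2_eq_iff_nonneg) auto
qed

lemma norm_one_minus_ee_le: "norm (1 - ee x) \<le> 2 * pi * \<bar>x\<bar>"
  using abs_sin_x_le_abs_x[of "pi * x"] by (simp add: norm_one_minus_ee abs_mult)

lemma norm_ee_diff_le: "norm (ee x - ee y) \<le> 2 * pi * \<bar>x - y\<bar>"
proof -
  have "ee x - ee y = ee x * (1 - ee (y - x))"
    using ee_add[of x "y - x"] by (simp add: algebra_simps)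
  then have "norm (ee x - ee y) = norm (1 - ee (y - x))"
    by (simp add: norm_mult)
  then show ?thesis
    using norm_one_minus_ee_le[of "y - x"] by (simp add: abs_minus_commute)
qed

text \<open>A geometric series with ratio \<open>ee c\<close>: the numerator is at most
  \<open>2\<close>, and Jordan's inequality bounds the denominator below by
  \<open>4 * \<bar>c\<bar>\<close>.\<close>

lemma norm_sum_ee_linear_le:
  fixes c :: real
  assumes "c \<noteq> 0" "\<bar>c\<bar> \<le> 1 / 2"
  shows "norm (\<Sum>h<n. ee (a + real h * c)) \<le> 1 / \<bar>c\<bar>"
proof -
  have lower: "4 * \<bar>c\<bar> \<le> norm (1 - ee c)"
    using sin_pi_ge[OF assms(2)] by (simp add: norm_one_minus_ee)
  have "(\<Sum>h<n. ee (a + real h * c)) = ee a * (\<Sum>h<n. ee c ^ h)"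
    by (simp add: ee_add ee_power sum_distrib_left)
  then have "norm (\<Sum>h<n. ee (a + real h * c)) = norm (\<Sum>h<n. ee c ^ h)"
    by (simp add: norm_mult)
  also have "\<dots> = norm (1 - ee c ^ n) / norm (1 - ee c)"
    using lower assms by (subst sum_gp_strict) (auto simp: norm_divide)
  also have "\<dots> \<le> 2 / (4 * \<bar>c\<bar>)"
  proof (rule frac_le)
    show "norm (1 - ee c ^ n) \<le> 2"
      using norm_triangle_ineq4[of 1 "ee c ^ n"] by (simp add: norm_power)
  qed (use lower assms in auto)
  also have "\<dots> \<le> 1 / \<bar>c\<bar>"
    using assms by (simp add: field_simps)
  finally show ?thesis .
qed

text \<open>Expanding the square gives a sum over pairs of indices, grouped here by their difference
  \<open>r\<close>. Pairs with differences \<open>r\<close> and \<open>-r\<close> are complex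
  conjugates, which accounts for \<open>2 * Re\<close>.\<close>

lemma norm_sum_sq_eq_correlations:
  fixes u :: "nat \<Rightarrow> complex"
  shows "(norm (\<Sum>h<n. u h))\<^sup>2 = (\<Sum>h<n. (norm (u h))\<^sup>2) +
    2 * Re (\<Sum>r=1..<n. \<Sum>h<n-r. u (h + r) * cnj (u h))"
proof (induction n)
  case (Suc n)
  let ?S = "\<Sum>h<n. u h"
  have corr: "(\<Sum>r=1..<Suc n. \<Sum>h<Suc n-r. u (h + r) * cnj (u h)) =
      (\<Sum>r=1..<n. \<Sum>h<n-r. u (h + r) * cnj (u h)) + u n * cnj ?S"
  proof -
    have "(\<Sum>r=1..<Suc n. \<Sum>h<Suc n-r. u (h + r) * cnj (u h)) =
        (\<Sum>r=1..<Suc n. (\<Sum>h<n-r. u (h + r) * cnj (u h)) + u n * cnj (u (n - r)))"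
      by (rule sum.cong) (auto simp: Suc_diff_le)
    also have "\<dots> = (\<Sum>r=1..<Suc n. \<Sum>h<n-r. u (h + r) * cnj (u h)) +
        (\<Sum>r=1..<Suc n. u n * cnj (u (n - r)))"
      by (rule sum.distrib)
    also have "(\<Sum>r=1..<Suc n. \<Sum>h<n-r. u (h + r) * cnj (u h)) =
        (\<Sum>r=1..<n. \<Sum>h<n-r. u (h + r) * cnj (u h))"
      by (cases n) auto
    \<comment> \<open>The pairs created by the new index \<open>n\<close> are
      \<open>(n, n - r)\<close>, one for each shift; together they give \<open>u n\<close> times the
      conjugate of the old sum.\<close>
    also have "(\<Sum>r=1..<Suc n. u n * cnj (u (n - r))) = (\<Sum>h<n. u n * cnj (u h))"
      by (rule sum.reindex_bij_witness[of _ "\<lambda>h. n - h" "\<lambda>r. n - r"]) auto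
    finally show ?thesis by (simp add: sum_distrib_left)
  qed
  have "(norm (z + w))\<^sup>2 = (norm z)\<^sup>2 + (norm w)\<^sup>2 + 2 * Re (w * cnj z)" for z w
    unfolding cmod_power2 by (simp add: power2_eq_square algebra_simps)
  from this[of ?S "u n"] have "(norm (\<Sum>h<Suc n. u h))\<^sup>2 =
      (norm ?S)\<^sup>2 + (norm (u n))\<^sup>2 + 2 * Re (u n * cnj ?S)"
    by simp
  with Suc.IH show ?case
    unfolding corr by (simp only: sum.lessThan_Suc plus_complex.sel distrib_left)
qed auto

text \<open>The step that lowers degrees: the correlation with shift \<open>r\<close> is again an
  exponential sum, and if \<open>u\<close> is a polynomial then its phase has one degree
  less.\<close>

lemma van_der_corput_ineq:
  fixes u :: "nat \<Rightarrow> real"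
  shows "(norm (\<Sum>h<n. ee (u h)))\<^sup>2 \<le>
    real n + 2 * (\<Sum>r=1..<n. norm (\<Sum>h<n-r. ee (u (h + r) - u h)))"
proof -
  have "(norm (\<Sum>h<n. ee (u h)))\<^sup>2 =
      real n + 2 * Re (\<Sum>r=1..<n. \<Sum>h<n-r. ee (u (h + r)) * cnj (ee (u h)))"
    by (simp only: norm_sum_sq_eq_correlations) simp
  also have "(\<Sum>r=1..<n. \<Sum>h<n-r. ee (u (h + r)) * cnj (ee (u h))) =
      (\<Sum>r=1..<n. \<Sum>h<n-r. ee (u (h + r) - u h))"
    by (simp add: cnj_ee flip: ee_add)
  also have "Re \<dots> \<le> norm \<dots>"
    by (rule complex_Re_le_cmod)
  also have "\<dots> \<le> (\<Sum>r=1..<n. norm (\<Sum>h<n-r. ee (u (h + r) - u h)))"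
    by (rule norm_sum)
  finally show ?thesis by simp
qed

section \<open>Iterated differences of polynomials and Weyl's bound\<close>

text \<open>The \<open>k\<close>-fold differences of \<open>P\<close> with steps \<open>r\<^sub>1, \<dots>, r\<^sub>k\<close> are constantly
  \<open>r\<^sub>1 \<cdots> r\<^sub>k c\<close>; for a polynomial of degree at most \<open>k\<close>, \<open>c\<close> is \<open>k!\<close> times its \<open>k\<close>-th coefficient.\<close>
primrec top_diff :: "nat \<Rightarrow> real \<Rightarrow> (nat \<Rightarrow> real) \<Rightarrow> bool" where
  "top_diff 0 c P \<longleftrightarrow> (\<forall>n. P n = c)"
| "top_diff (Suc k) c P \<longleftrightarrow> (\<forall>r. top_diff k (real r * c) (\<lambda>n. P (n + r) - P n))"

lemma top_diff_add:
  "top_diff k a P \<Longrightarrow> top_diff k b Q \<Longrightarrow> top_diff k (a + b) (\<lambda>n. P n + Q n)"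
proof (induction k arbitrary: a b P Q)
  case (Suc k)
  have "top_diff k (real r * a + real r * b)
      (\<lambda>n. (P (n + r) - P n) + (Q (n + r) - Q n))" for r
    using Suc by simp
  then show ?case by (simp add: algebra_simps)
qed auto

lemma top_diff_cmult: "top_diff k a P \<Longrightarrow> top_diff k (b * a) (\<lambda>n. b * P n)"
proof (induction k arbitrary: a P)
  case (Suc k)
  have "top_diff k (b * (real r * a)) (\<lambda>n. b * (P (n + r) - P n))" for r
    using Suc by simp
  then show ?case by (simp add: algebra_simps)
qed auto

lemma top_diff_zero: "top_diff k 0 (\<lambda>_. 0)"
  by (induction k) auto

lemma top_diff_sum:
  assumes "finite I" "\<And>i. i \<in> I \<Longrightarrow> top_diff k (a i) (P i)"
  shows "top_diff k (\<Sum>i\<in>I. a i) (\<lambda>n. \<Sum>i\<in>I. P i n)"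
  using assms by (induction rule: finite_induct) (auto intro: top_diff_zero top_diff_add)

text \<open>By the binomial theorem, a difference of \<open>n ^ j\<close> with step \<open>r\<close>
  is a polynomial of degree \<open>j - 1\<close> with leading coefficient \<open>j * r\<close>;
  induction on \<open>k\<close> then produces the factorial.\<close>

lemma top_diff_power:
  "j \<le> k \<Longrightarrow> top_diff k (if j = k then fact k else 0) (\<lambda>n. real n ^ j)"
proof (induction k arbitrary: j)
  case (Suc k)
  show ?case
  proof (simp only: top_diff.simps, intro allI)
    fix r
    \<comment> \<open>Since \<open>i < j \<le> Suc k\<close>, the term \<open>i = k\<close> is
      present only for \<open>j = Suc k\<close>, where its coefficient is
      \<open>Suc k * r\<close>.\<close>
    have "(\<Sum>i<j. (real (j choose i) * real r ^ (j - i)) * (if i = k then fact k else 0)) =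
        real r * (if j = Suc k then fact (Suc k) else 0)"
      using Suc.prems by (auto simp: if_distrib sum.delta cong: if_cong)
    moreover have "top_diff k
        (\<Sum>i<j. (real (j choose i) * real r ^ (j - i)) * (if i = k then fact k else 0))
        (\<lambda>n. \<Sum>i<j. (real (j choose i) * real r ^ (j - i)) * real n ^ i)"
      using Suc by (intro top_diff_sum top_diff_cmult) auto
    moreover have "(\<lambda>n. \<Sum>i<j. (real (j choose i) * real r ^ (j - i)) * real n ^ i) =
        (\<lambda>n. real (n + r) ^ j - real n ^ j)"
      by (rule ext) (simp add: binomial_ring lessThan_Suc_atMost[symmetric] mult_ac)
    ultimately show "top_diff k (real r * (if j = Suc k then fact (Suc k) else 0))
        (\<lambda>n. real (n + r) ^ j - real n ^ j)"
      by simp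
  qed
qed auto

lemma top_diff_poly:
  "top_diff k (fact k * a k) (\<lambda>n. \<Sum>j\<le>k. a j * real n ^ j)"
proof -
  have "top_diff k (\<Sum>j\<le>k. a j * (if j = k then fact k else 0)) (\<lambda>n. \<Sum>j\<le>k. a j * real n ^ j)"
    by (intro top_diff_sum top_diff_cmult top_diff_power) auto
  also have "(\<Sum>j\<le>k. a j * (if j = k then fact k else 0)) = fact k * a k"
    by (simp add: if_distrib sum.delta cong: if_cong)
  finally show ?thesis .
qed

text \<open>Induction on the degree through \<open>van_der_corput_ineq\<close>, starting from linear
  phases. The bound \<open>\<bar>c\<bar> * H ^ k \<le> 1 / 2\<close> keeps the slope left after
  \<open>k\<close> differences with steps below \<open>H\<close> within \<open>1 / 2\<close>, as the
  geometric sum requires. Each step costs a factor \<open>4\<close> in the exponent: one factor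
  \<open>2\<close> from the square root and another from the cutoff on the shifts.\<close>

lemma weyl_bound:
  "\<exists>C\<ge>1. \<forall>c P H n. top_diff (Suc k) c P \<longrightarrow> n \<le> H \<longrightarrow> \<bar>c\<bar> * real H ^ k \<le> 1 / 2 \<longrightarrow>
     1 \<le> \<bar>c\<bar> * real H ^ Suc k \<longrightarrow>
     norm (\<Sum>h<n. ee (P h)) \<le> C * real H * (\<bar>c\<bar> * real H ^ Suc k) powr (- (1 / 4 ^ k))"
proof (induction k)
  case 0
  have "norm (\<Sum>h<n. ee (P h)) \<le> real H * (\<bar>c\<bar> * real H) powr - 1"
    if P: "top_diff (Suc 0) c P" and c: "\<bar>c\<bar> \<le> 1 / 2" and X: "1 \<le> \<bar>c\<bar> * real H" for c P H n
  proof -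
    have "c \<noteq> 0" using X by auto
    have "P h = P 0 + real h * c" for h
    proof -
      have "P (0 + h) - P 0 = real h * c"
        using P unfolding top_diff.simps by blast
      then show ?thesis by simp
    qed
    then have "norm (\<Sum>h<n. ee (P h)) = norm (\<Sum>h<n. ee (P 0 + real h * c))"
      by metis
    also have "\<dots> \<le> 1 / \<bar>c\<bar>"
      using \<open>c \<noteq> 0\<close> c by (rule norm_sum_ee_linear_le)
    also have "\<dots> = real H * (\<bar>c\<bar> * real H) powr - 1"
      using X \<open>c \<noteq> 0\<close> by (cases "H = 0") (auto simp: powr_minus_divide)
    finally show ?thesis .
  qed
  then show ?case by (intro exI[of _ 1]) auto
next
  case (Suc k)
  then obtain C where C: "C \<ge> 1"
    and IH: "\<And>c P H n. top_diff (Suc k) c P \<Longrightarrow> n \<le> H \<Longrightarrow> \<bar>c\<bar> * real H ^ k \<le> 1 / 2 \<Longrightarrow>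
     1 \<le> \<bar>c\<bar> * real H ^ Suc k \<Longrightarrow>
     norm (\<Sum>h<n. ee (P h)) \<le> C * real H * (\<bar>c\<bar> * real H ^ Suc k) powr (- (1 / 4 ^ k))"
    by blast
  define \<sigma> :: real where "\<sigma> = 1 / 4 ^ k"
  have \<sigma>: "0 < \<sigma>" "\<sigma> \<le> 1"
    by (auto simp: \<sigma>_def)
  have "norm (\<Sum>h<n. ee (P h)) \<le> (3 + 2 * C) * real H * (\<bar>c\<bar> * real H ^ Suc (Suc k)) powr (- (\<sigma> / 4))"
    if P: "top_diff (Suc (Suc k)) c P" and n: "n \<le> H" and c: "\<bar>c\<bar> * real H ^ Suc k \<le> 1 / 2"
      and X1: "1 \<le> \<bar>c\<bar> * real H ^ Suc (Suc k)" for c P H n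
  proof -
    define X where "X = \<bar>c\<bar> * real H ^ Suc (Suc k)"
    have X: "X \<ge> 1" using X1 by (simp add: X_def)
    have H: "H > 0" using X1 by (cases "H = 0") auto
    have XH: "X \<le> real H"
    proof -
      have "X = (\<bar>c\<bar> * real H ^ Suc k) * real H" by (simp add: X_def)
      also have "\<dots> \<le> 1 / 2 * real H" by (rule mult_right_mono[OF c]) simp
      finally show ?thesis using H by simp
    qed
    \<comment> \<open>The cutoff for the shifts. Fewer than \<open>y\<close> of them are estimated
      trivially, for a total of at most \<open>H\<^sup>2 * X powr (-1/2)\<close>; for all others the
      differenced phase still has scale \<open>X' \<ge> X powr (1/2)\<close>, so the induction
      hypothesis applies.\<close>
    define y where "y = real H * X powr (-1/2)"
    define T where "T r = norm (\<Sum>h<n-r. ee (P (h + r) - P h))" for r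
    have T: "T r \<le> C * real H * X powr (- (\<sigma> / 2)) + (if real r < y then real H else 0)"
      if r: "r \<in> {1..<n}" for r
    proof (cases "real r < y")
      case True
      have "T r \<le> real (n - r)"
        unfolding T_def by (rule order_trans[OF norm_sum]) simp
      also have "\<dots> \<le> real H" using n by simp
      finally show ?thesis using True C by (simp add: add_increasing)
    next
      case False
      define X' where "X' = \<bar>real r * c\<bar> * real H ^ Suc k"
      have "X powr (1/2) = X * X powr (-1/2)"
        using X by (simp add: powr_mult_base)
      also have "\<dots> = \<bar>c\<bar> * real H ^ Suc k * y"
        by (simp add: X_def y_def mult_ac)
      also have "\<dots> \<le> \<bar>c\<bar> * real H ^ Suc k * real r"
        using False by (intro mult_left_mono) auto
      also have "\<dots> = X'" by (simp add: X'_def abs_mult mult_ac)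
      finally have X': "X powr (1/2) \<le> X'" .
      have "1 \<le> X powr (1/2)" using X by (simp add: ge_one_powr_ge_zero)
      have "T r \<le> C * real H * X' powr (- \<sigma>)"
        unfolding T_def X'_def \<sigma>_def
      proof (rule IH)
        show "top_diff (Suc k) (real r * c) (\<lambda>h. P (h + r) - P h)"
          using P unfolding top_diff.simps by blast
        show "n - r \<le> H" using n by simp
        have "\<bar>real r * c\<bar> * real H ^ k = real r * (\<bar>c\<bar> * real H ^ k)" by (simp add: abs_mult)
        also have "\<dots> \<le> real H * (\<bar>c\<bar> * real H ^ k)"
          using r n by (intro mult_right_mono) auto
        also have "\<dots> \<le> 1 / 2" using c by (simp add: mult_ac)
        finally show "\<bar>real r * c\<bar> * real H ^ k \<le> 1 / 2" .
        show "1 \<le> \<bar>real r * c\<bar> * real H ^ Suc k"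
          using X' \<open>1 \<le> X powr (1/2)\<close> by (simp add: X'_def)
      qed
      also have "X' powr (- \<sigma>) \<le> (X powr (1/2)) powr (- \<sigma>)"
        using X' \<open>1 \<le> X powr (1/2)\<close> \<sigma> by (intro powr_mono2') auto
      also have "\<dots> = X powr (- (\<sigma> / 2))" by (simp add: powr_powr)
      finally show ?thesis using C False by (simp add: mult_left_mono)
    qed
    have card: "real (card {r \<in> {1..<n}. real r < y}) \<le> y"
    proof -
      have "y \<ge> 0" by (simp add: y_def)
      have "{r \<in> {1..<n}. real r < y} \<subseteq> {1..nat \<lfloor>y\<rfloor>}"
        by (auto simp: le_nat_floor)
      then have "card {r \<in> {1..<n}. real r < y} \<le> nat \<lfloor>y\<rfloor>"
        using card_mono[of "{1..nat \<lfloor>y\<rfloor>}"] by fastforce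
      also have "real (nat \<lfloor>y\<rfloor>) \<le> y" using \<open>y \<ge> 0\<close> by simp
      finally show ?thesis by simp
    qed
    have mono: "X powr (-1/2) \<le> X powr (- (\<sigma> / 2))" "X powr (-1) \<le> X powr (- (\<sigma> / 2))"
      using X \<sigma> by (intro powr_mono; simp)+
    have "(\<Sum>r=1..<n. T r) \<le>
        (\<Sum>r=1..<n. C * real H * X powr (- (\<sigma> / 2)) + (if real r < y then real H else 0))"
      by (intro sum_mono T)
    also have "\<dots> = real (n - 1) * (C * real H * X powr (- (\<sigma> / 2))) +
        real (card {r \<in> {1..<n}. real r < y}) * real H"
      by (simp add: sum.distrib sum.If_cases Int_def)
    also have "\<dots> \<le> real H * (C * real H * X powr (- (\<sigma> / 2))) + y * real H"
      using n C card by (intro add_mono mult_right_mono) auto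
    also have "\<dots> \<le> real H * (C * real H * X powr (- (\<sigma> / 2))) +
        real H * X powr (- (\<sigma> / 2)) * real H"
      unfolding y_def using mono by (intro add_mono mult_right_mono mult_left_mono) auto
    finally have sumT: "(\<Sum>r=1..<n. T r) \<le> (C + 1) * (real H)\<^sup>2 * X powr (- (\<sigma> / 2))"
      by (simp add: algebra_simps power2_eq_square)
    \<comment> \<open>The diagonal fits into the same bound because \<open>X \<le> H\<close>, so
      that \<open>n \<le> H\<^sup>2 / X\<close>.\<close>
    have diag: "real n \<le> (real H)\<^sup>2 * X powr (- (\<sigma> / 2))"
    proof -
      have "real n \<le> real H * real H * X powr (-1)"
        using n XH X H by (simp add: powr_minus_divide field_simps mult_mono)
      also have "\<dots> \<le> real H * real H * X powr (- (\<sigma> / 2))"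
        by (intro mult_left_mono mono) simp
      finally show ?thesis by (simp add: power2_eq_square)
    qed
    have "(norm (\<Sum>h<n. ee (P h)))\<^sup>2 \<le> real n + 2 * (\<Sum>r=1..<n. T r)"
      unfolding T_def by (rule van_der_corput_ineq)
    also have "\<dots> \<le> (3 + 2 * C) * ((real H)\<^sup>2 * X powr (- (\<sigma> / 2)))"
      using diag sumT by (simp add: algebra_simps)
    also have "\<dots> \<le> (3 + 2 * C)\<^sup>2 * ((real H)\<^sup>2 * X powr (- (\<sigma> / 2)))"
      using C by (intro mult_right_mono self_le_power) auto
    also have "\<dots> = ((3 + 2 * C) * real H * X powr (- (\<sigma> / 4)))\<^sup>2"
      by (simp add: power_mult_distrib power2_eq_square flip: powr_add)
    finally show ?thesis
      unfolding X_def[symmetric] by (rule power2_le_imp_le) (use C in auto)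
  qed
  then show ?case
    using C by (intro exI[of _ "3 + 2 * C"]) (auto simp: \<sigma>_def mult.commute)
qed

section \<open>Power saving from derivative bounds\<close>

lemma norm_sum_shift_diff_le:
  fixes u :: "nat \<Rightarrow> 'a :: real_normed_vector"
  assumes "a \<le> b" "\<And>n. norm (u n) \<le> 1"
  shows "norm ((\<Sum>n=a..<b. u n) - (\<Sum>n=a..<b. u (n + h))) \<le> 2 * real h"
proof (induction h)
  case (Suc h)
  have "(\<Sum>n=a..<b. u (Suc n + h) - u (n + h)) = u (b + h) - u (a + h)"
    using assms(1) by (rule sum_Suc_diff')
  then have tele: "(\<Sum>n=a..<b. u (n + h)) - (\<Sum>n=a..<b. u (n + Suc h)) = u (a + h) - u (b + h)"
    by (simp add: sum_subtractf algebra_simps)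
  have "norm ((\<Sum>n=a..<b. u n) - (\<Sum>n=a..<b. u (n + Suc h))) =
      norm (((\<Sum>n=a..<b. u n) - (\<Sum>n=a..<b. u (n + h))) + (u (a + h) - u (b + h)))"
    unfolding tele[symmetric] by simp
  also have "\<dots> \<le> 2 * real h + (1 + 1)"
    by (intro order_trans[OF norm_triangle_ineq] add_mono Suc.IH
        order_trans[OF norm_triangle_ineq4] assms)
  finally show ?case by simp
qed auto

text \<open>Shifting the summation range by \<open>h < H\<close> changes the sum by at most
  \<open>2 * H\<close>. Averaging over all these shifts replaces the long sum by a mean of sums over
  blocks of length \<open>H\<close>, which are short enough for Taylor approximation.\<close>

lemma norm_sum_le_block_average:
  fixes u :: "nat \<Rightarrow> complex"
  assumes "a \<le> b" "\<And>n. norm (u n) \<le> 1" "H > 0"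
    and block: "\<And>M. M \<in> {a..<b} \<Longrightarrow> norm (\<Sum>h<H. u (M + h)) \<le> real H * B"
  shows "norm (\<Sum>n=a..<b. u n) \<le> real (b - a) * B + 2 * real H"
proof -
  let ?S = "\<Sum>n=a..<b. u n"
  have "of_nat H * ?S = (\<Sum>h<H. ?S - (\<Sum>n=a..<b. u (n + h))) + (\<Sum>h<H. \<Sum>n=a..<b. u (n + h))"
    by (simp add: sum_subtractf)
  also have "(\<Sum>h<H. \<Sum>n=a..<b. u (n + h)) = (\<Sum>n=a..<b. \<Sum>h<H. u (n + h))"
    by (rule sum.swap)
  finally have "norm (of_nat H * ?S) \<le>
      norm (\<Sum>h<H. ?S - (\<Sum>n=a..<b. u (n + h))) + norm (\<Sum>n=a..<b. \<Sum>h<H. u (n + h))"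
    by (simp add: norm_triangle_ineq)
  also have "norm (\<Sum>h<H. ?S - (\<Sum>n=a..<b. u (n + h))) \<le> (\<Sum>h<H. 2 * real H)"
  proof (rule sum_norm_le)
    fix h assume "h \<in> {..<H}"
    then show "norm (?S - (\<Sum>n=a..<b. u (n + h))) \<le> 2 * real H"
      using norm_sum_shift_diff_le[of a b u h, OF assms(1,2)] by simp
  qed
  also have "norm (\<Sum>n=a..<b. \<Sum>h<H. u (n + h)) \<le> (\<Sum>n=a..<b. real H * B)"
    by (rule sum_norm_le) (use block in auto)
  finally have "real H * norm ?S \<le> real H * (real (b - a) * B + 2 * real H)"
    by (simp add: norm_mult algebra_simps)
  then show ?thesis using \<open>H > 0\<close> by simp
qed

text \<open>On a block the phase differs from its Taylor polynomial by a Lagrange remainder of size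
  at most \<open>E\<close>, and \<open>ee\<close> is Lipschitz with constant
  \<open>2 * pi\<close>.\<close>

lemma norm_sum_ee_taylor_le:
  fixes D :: "nat \<Rightarrow> real \<Rightarrow> real"
  assumes deriv: "\<And>m x. x > 0 \<Longrightarrow> (D m has_real_derivative D (Suc m) x) (at x)"
    and M: "M > 0"
    and err: "\<And>x. x \<ge> real M \<Longrightarrow> \<bar>\<beta> * D (Suc k) x\<bar> * real H ^ Suc k \<le> E"
  shows "norm (\<Sum>h<H. ee (\<beta> * D 0 (real (M + h)))) \<le>
    norm (\<Sum>h<H. ee (\<Sum>j\<le>k. (\<beta> * D j (real M) / fact j) * real h ^ j)) + 2 * pi * real H * E"
proof -
  define P where "P h = (\<Sum>j\<le>k. (\<beta> * D j (real M) / fact j) * real h ^ j)" for h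
  have E: "E \<ge> 0"
    using err[of "real M"] by (smt (verit) mult_nonneg_nonneg abs_ge_zero of_nat_0_le_iff zero_le_power)
  have diff: "\<bar>\<beta> * D 0 (real (M + h)) - P h\<bar> \<le> E" if h: "h < H" for h
  proof (cases "h = 0")
    case True
    have "P 0 = (\<Sum>j\<le>k. if j = 0 then \<beta> * D 0 (real M) else 0)"
      unfolding P_def by (intro sum.cong) auto
    then show ?thesis using True E by simp
  next
    case False
    have "\<exists>x. real M < x \<and> x < real (M + h) \<and> D 0 (real (M + h)) =
        (\<Sum>m<Suc k. (D m (real M) / fact m) * (real (M + h) - real M) ^ m) +
        (D (Suc k) x / fact (Suc k)) * (real (M + h) - real M) ^ Suc k"
      by (rule Taylor_up[of _ D _ "real M"]) (use deriv M False in auto)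
    then obtain x where x: "real M < x" and
      eq: "D 0 (real (M + h)) = (\<Sum>m<Suc k. (D m (real M) / fact m) * real h ^ m) +
        (D (Suc k) x / fact (Suc k)) * real h ^ Suc k"
      by auto
    have "\<beta> * (\<Sum>m<Suc k. (D m (real M) / fact m) * real h ^ m) = P h"
      unfolding P_def sum_distrib_left lessThan_Suc_atMost by (simp add: mult_ac)
    then have "\<beta> * D 0 (real (M + h)) - P h = (\<beta> * D (Suc k) x) * real h ^ Suc k / fact (Suc k)"
      unfolding eq by (simp add: distrib_left del: fact_Suc)
    then have "\<bar>\<beta> * D 0 (real (M + h)) - P h\<bar> = \<bar>\<beta> * D (Suc k) x\<bar> * real h ^ Suc k / fact (Suc k)"
      by (simp add: abs_mult del: fact_Suc power_Suc)
    also have "\<dots> \<le> \<bar>\<beta> * D (Suc k) x\<bar> * real h ^ Suc k / 1"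
      by (intro divide_left_mono) (auto simp del: fact_Suc intro!: fact_ge_1)
    also have "\<dots> \<le> \<bar>\<beta> * D (Suc k) x\<bar> * real H ^ Suc k"
      using h by (auto intro!: mult_left_mono power_mono simp del: power_Suc)
    also have "\<dots> \<le> E" using err x by simp
    finally show ?thesis .
  qed
  have "norm ((\<Sum>h<H. ee (\<beta> * D 0 (real (M + h)))) - (\<Sum>h<H. ee (P h))) \<le> (\<Sum>h<H. 2 * pi * E)"
    unfolding sum_subtractf[symmetric]
  proof (rule sum_norm_le)
    fix h assume "h \<in> {..<H}"
    then have "2 * pi * \<bar>\<beta> * D 0 (real (M + h)) - P h\<bar> \<le> 2 * pi * E"
      by (intro mult_left_mono diff) auto
    then show "norm (ee (\<beta> * D 0 (real (M + h))) - ee (P h)) \<le> 2 * pi * E"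
      using norm_ee_diff_le by (rule order_trans[rotated])
  qed
  then show ?thesis
    unfolding P_def[symmetric] using norm_triangle_sub[of "\<Sum>h<H. ee (\<beta> * D 0 (real (M + h)))" "\<Sum>h<H. ee (P h)"]
    by (simp add: mult_ac)
qed

text \<open>The block length \<open>N powr (1 - 4 s)\<close> makes the \<open>k\<close>-th Taylor term of the phase a small positive
  power of \<open>N\<close> and the \<open>k + 1\<close>-st a negative one, for all \<open>\<beta>\<close> in the given range at once.\<close>
lemma exp_sum_power_saving:
  fixes D :: "nat \<Rightarrow> real \<Rightarrow> real"
  assumes deriv: "\<And>m x. x > 0 \<Longrightarrow> (D m has_real_derivative D (Suc m) x) (at x)"
    and t: "0 < t" "2 * t < real k" and c: "0 < c1" "0 < c2"
    and low: "\<forall>\<^sub>F x in at_top. c1 * x powr (t - real k) \<le> \<bar>D k x\<bar>"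
    and up: "\<forall>\<^sub>F x in at_top. \<bar>D k x\<bar> \<le> c2 * x powr (t - real k)"
    and up': "\<forall>\<^sub>F x in at_top. \<bar>D (Suc k) x\<bar> \<le> c2 * x powr (t - real (Suc k))"
  shows "\<exists>s>0. \<exists>\<kappa>>0. s < 1 \<and> (\<forall>\<^sub>F N in sequentially. \<forall>\<beta>. real N powr (- s) \<le> \<bar>\<beta>\<bar> \<longrightarrow> \<bar>\<beta>\<bar> \<le> real N powr s \<longrightarrow>
    norm (\<Sum>n=N..<2*N. ee (\<beta> * D 0 (real n))) \<le> real N powr (1 - \<kappa>))"
proof -
  have "k > 0" using t by (cases "k = 0") auto
  then obtain k' where k': "k = Suc k'" by (cases k) auto
  obtain C where C: "C \<ge> 1"
    and weyl: "\<And>c P H n. top_diff k c P \<Longrightarrow> n \<le> H \<Longrightarrow> \<bar>c\<bar> * real H ^ k' \<le> 1 / 2 \<Longrightarrow>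
     1 \<le> \<bar>c\<bar> * real H ^ k \<Longrightarrow>
     norm (\<Sum>h<n. ee (P h)) \<le> C * real H * (\<bar>c\<bar> * real H ^ k) powr (- (1 / 4 ^ k'))"
    using weyl_bound[of k'] unfolding k' by blast
  define \<sigma> :: real where "\<sigma> = 1 / 4 ^ k'"
  have \<sigma>: "0 < \<sigma>" "\<sigma> \<le> 1" by (auto simp: \<sigma>_def)
  \<comment> \<open>With \<open>t = (4 * k + 2) * s\<close> and blocks of length about
    \<open>N powr (1 - 4 * s)\<close>, the top Taylor term has order at least
    \<open>-s + t - k + (1 - 4 * s) * k = s\<close> in \<open>N\<close>, and the remainder at most
    \<open>s + t - (k + 1) + (1 - 4 * s) * (k + 1) = -s\<close>. The smallness condition in Weyl's
    bound leads to the exponent \<open>7 * s - 1\<close>, negative because \<open>2 * t < k\<close>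
    forces \<open>s < 1 / 8\<close>.\<close>
  define s where "s = t / (4 * real k + 2)"
  have s: "s > 0" using t by (simp add: s_def)
  have ts: "t = (4 * real k + 2) * s" by (simp add: s_def field_simps)
  have s8: "s < 1 / 8"
    using t by (simp add: s_def field_simps)
  \<comment> \<open>The factor \<open>2 powr (t - k)\<close> pays for block positions
    \<open>M\<close> up to \<open>2 * N\<close>, since the power \<open>t - k\<close> is
    decreasing.\<close>
  define c1' where "c1' = c1 * 2 powr (t - real k)"
  have c1': "c1' > 0" using c by (simp add: c1'_def)
  \<comment> \<open>\<open>K\<close> collects the constants from Weyl's bound, the Taylor error and
    the block ends. The total saving is \<open>s * \<sigma>\<close>; only half of it is claimed as
    \<open>\<kappa>\<close>, and the other half absorbs \<open>K\<close>.\<close>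
  define K where "K = C * c1' powr (- \<sigma>) + 2 * pi * (c2 * 2 ^ Suc k) + 4"
  define \<kappa> where "\<kappa> = s * \<sigma> / 2"
  have \<kappa>: "\<kappa> > 0" using s \<sigma> by (simp add: \<kappa>_def)
  obtain x0 where x0: "\<And>x. x \<ge> x0 \<Longrightarrow> c1 * x powr (t - real k) \<le> \<bar>D k x\<bar>"
      "\<And>x. x \<ge> x0 \<Longrightarrow> \<bar>D k x\<bar> \<le> c2 * x powr (t - real k)"
      "\<And>x. x \<ge> x0 \<Longrightarrow> \<bar>D (Suc k) x\<bar> \<le> c2 * x powr (t - real (Suc k))"
    using eventually_conj[OF low eventually_conj[OF up up']]
    by (auto simp: eventually_at_top_linorder)
  have "\<forall>\<^sub>F N in sequentially. real N \<ge> max 1 x0"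
    by real_asymp
  moreover have "\<forall>\<^sub>F N in sequentially. c1' * real N powr s \<ge> 1"
    using s c1' by real_asymp
  moreover have "\<forall>\<^sub>F N in sequentially. c2 * 2 ^ k' * real N powr (7 * s - 1) \<le> 1 / 2"
    using s8 c by real_asymp
  moreover have "\<forall>\<^sub>F N in sequentially. K \<le> real N powr \<kappa>"
    using \<kappa> by real_asymp
  ultimately have "\<forall>\<^sub>F N in sequentially. \<forall>\<beta>. real N powr (- s) \<le> \<bar>\<beta>\<bar> \<longrightarrow> \<bar>\<beta>\<bar> \<le> real N powr s \<longrightarrow>
    norm (\<Sum>n=N..<2*N. ee (\<beta> * D 0 (real n))) \<le> real N powr (1 - \<kappa>)"
  proof eventually_elim
    case (elim N)
    show ?case
    proof (intro allI impI)
      fix \<beta> assume \<beta>: "real N powr (- s) \<le> \<bar>\<beta>\<bar>" "\<bar>\<beta>\<bar> \<le> real N powr s"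
      define x where "x = real N"
      have x: "x \<ge> 1" "x \<ge> x0" using elim by (auto simp: x_def)
      define y where "y = x powr (1 - 4 * s)"
      have y: "y \<ge> 1" using x s8 by (simp add: y_def ge_one_powr_ge_zero)
      have ypow: "y ^ j = x powr ((1 - 4 * s) * real j)" for j
        using x by (simp add: y_def powr_powr flip: powr_realpow)
      define H where "H = nat \<lceil>y\<rceil>"
      have H: "y \<le> real H" "real H \<le> 2 * y" "H > 0"
        using y unfolding H_def by linarith+
      have block: "norm (\<Sum>h<H. ee (\<beta> * D 0 (real (M + h)))) \<le>
          real H * (C * (c1' * x powr s) powr (- \<sigma>) + 2 * pi * (c2 * 2 ^ Suc k * x powr (- s)))"
        if M: "M \<in> {N..<2*N}" for M
      proof -
        have M': "x \<le> real M" "real M \<le> 2 * x" "M > 0"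
          using M x by (auto simp: x_def)
        define c where "c = \<beta> * D k (real M)"
        have "(c1' * x powr s) = x powr (- s) * (c1 * (2 * x) powr (t - real k)) * y ^ k"
        proof -
          have "x powr s = x powr (- s) * x powr (t - real k) * y ^ k"
            unfolding ypow ts by (simp add: algebra_simps flip: powr_add)
          then show ?thesis
            using x by (simp add: c1'_def powr_mult)
        qed
        also have "\<dots> \<le> \<bar>\<beta>\<bar> * \<bar>D k (real M)\<bar> * real H ^ k"
        proof (intro mult_mono power_mono)
          have "c1 * (2 * x) powr (t - real k) \<le> c1 * real M powr (t - real k)"
            using t c M' x by (intro mult_left_mono powr_mono2') auto
          also have "\<dots> \<le> \<bar>D k (real M)\<bar>" using x0 M' x by simp
          finally show "c1 * (2 * x) powr (t - real k) \<le> \<bar>D k (real M)\<bar>" .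
        qed (use \<beta> H y c x in \<open>auto simp: x_def\<close>)
        also have "\<dots> = \<bar>c\<bar> * real H ^ k" by (simp add: c_def abs_mult)
        finally have X: "c1' * x powr s \<le> \<bar>c\<bar> * real H ^ k" .
        have X1: "1 \<le> c1' * x powr s" using elim by (simp add: x_def)
        have "\<bar>c\<bar> * real H ^ k' = \<bar>\<beta>\<bar> * \<bar>D k (real M)\<bar> * real H ^ k'"
          by (simp add: c_def abs_mult)
        also have "\<dots> \<le> x powr s * (c2 * x powr (t - real k)) * (2 * y) ^ k'"
        proof (intro mult_mono power_mono)
          have "\<bar>D k (real M)\<bar> \<le> c2 * real M powr (t - real k)"
            using x0 M' x by simp
          also have "\<dots> \<le> c2 * x powr (t - real k)"
            using t c M' x by (intro mult_left_mono powr_mono2') auto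
          finally show "\<bar>D k (real M)\<bar> \<le> c2 * x powr (t - real k)" .
        qed (use \<beta> H y c x in \<open>auto simp: x_def\<close>)
        also have "\<dots> = c2 * 2 ^ k' * x powr (7 * s - 1)"
          unfolding power_mult_distrib ypow ts k'
          by (simp add: algebra_simps flip: powr_add)
        also have "\<dots> \<le> 1 / 2" using elim by (simp add: x_def)
        finally have c_small: "\<bar>c\<bar> * real H ^ k' \<le> 1 / 2" .
        have err: "\<bar>\<beta> * D (Suc k) z\<bar> * real H ^ Suc k \<le> c2 * 2 ^ Suc k * x powr (- s)"
          if z: "z \<ge> real M" for z
        proof -
          have "\<bar>\<beta> * D (Suc k) z\<bar> * real H ^ Suc k = \<bar>\<beta>\<bar> * \<bar>D (Suc k) z\<bar> * real H ^ Suc k"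
            by (simp add: abs_mult)
          also have "\<dots> \<le> x powr s * (c2 * x powr (t - real (Suc k))) * (2 * y) ^ Suc k"
          proof (intro mult_mono power_mono)
            have "\<bar>D (Suc k) z\<bar> \<le> c2 * z powr (t - real (Suc k))"
              using x0 M' x z by simp
            also have "\<dots> \<le> c2 * x powr (t - real (Suc k))"
              using t c M' x z by (intro mult_left_mono powr_mono2') auto
            finally show "\<bar>D (Suc k) z\<bar> \<le> c2 * x powr (t - real (Suc k))" .
          qed (use \<beta> H y c x in \<open>auto simp: x_def\<close>)
          also have "\<dots> = c2 * 2 ^ Suc k * x powr (- s)"
            unfolding power_mult_distrib ypow ts
            by (simp add: algebra_simps flip: powr_add)
          finally show ?thesis .
        qed
        define P where "P h = (\<Sum>j\<le>k. (\<beta> * D j (real M) / fact j) * real h ^ j)" for h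
        have "top_diff k (fact k * (\<beta> * D k (real M) / fact k)) P"
          unfolding P_def by (rule top_diff_poly)
        then have "top_diff k c P" by (simp add: c_def)
        then have "norm (\<Sum>h<H. ee (P h)) \<le> C * real H * (\<bar>c\<bar> * real H ^ k) powr (- \<sigma>)"
          unfolding \<sigma>_def using c_small X X1 by (intro weyl) auto
        also have "\<dots> \<le> C * real H * (c1' * x powr s) powr (- \<sigma>)"
          using C X X1 \<sigma> by (intro mult_left_mono powr_mono2') auto
        finally have "norm (\<Sum>h<H. ee (P h)) \<le> C * real H * (c1' * x powr s) powr (- \<sigma>)" .
        moreover have "norm (\<Sum>h<H. ee (\<beta> * D 0 (real (M + h)))) \<le> norm (\<Sum>h<H. ee (P h)) +
            2 * pi * real H * (c2 * 2 ^ Suc k * x powr (- s))"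
          unfolding P_def by (rule norm_sum_ee_taylor_le) (use deriv M' err in auto)
        ultimately show ?thesis by (simp add: algebra_simps)
      qed
      have "norm (\<Sum>n=N..<2*N. ee (\<beta> * D 0 (real n))) \<le> real (2 * N - N) *
          (C * (c1' * x powr s) powr (- \<sigma>) + 2 * pi * (c2 * 2 ^ Suc k * x powr (- s))) + 2 * real H"
        by (rule norm_sum_le_block_average) (use block H in auto)
      also have "\<dots> \<le> x * (C * c1' powr (- \<sigma>) * x powr (- (s * \<sigma>)) +
          2 * pi * (c2 * 2 ^ Suc k) * x powr (- s)) + 4 * y"
        using H x c1' by (simp add: x_def[symmetric] powr_mult powr_powr algebra_simps)
      \<comment> \<open>The three savings have exponents \<open>s * \<sigma>\<close>,
        \<open>s\<close> and \<open>4 * s\<close>; all are weakened to the smallest one.\<close>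
      also have "\<dots> \<le> x * (C * c1' powr (- \<sigma>) * x powr (- (s * \<sigma>)) +
          2 * pi * (c2 * 2 ^ Suc k) * x powr (- (s * \<sigma>))) + 4 * (x * x powr (- (s * \<sigma>)))"
      proof (intro add_mono mult_left_mono order_refl)
        have *: "s * \<sigma> \<le> s" using s \<sigma> by simp
        show "x powr (- s) \<le> x powr (- (s * \<sigma>))"
          using x * by (intro powr_mono) auto
        have "y \<le> x powr (1 - s * \<sigma>)"
          unfolding y_def using x * s by (intro powr_mono) auto
        also have "\<dots> = x * x powr (- (s * \<sigma>))"
          using x by (simp add: powr_mult_base)
        finally show "y \<le> x * x powr (- (s * \<sigma>))" .
      qed (use x c C in auto)
      also have "\<dots> = K * (x * x powr (- (s * \<sigma>)))"
        by (simp add: K_def algebra_simps)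
      also have "\<dots> \<le> x powr \<kappa> * (x * x powr (- (s * \<sigma>)))"
        using elim x by (intro mult_right_mono) (auto simp: x_def)
      also have "\<dots> = x powr (1 - \<kappa>)"
        using x by (simp add: powr_mult_base \<kappa>_def mult.commute flip: powr_add)
      finally show "norm (\<Sum>n=N..<2*N. ee (\<beta> * D 0 (real n))) \<le> real N powr (1 - \<kappa>)"
        by (simp add: x_def)
    qed
  qed
  moreover have "s < 1" using s8 by simp
  ultimately show ?thesis using s \<kappa> by blast
qed

section \<open>A nonnegative trigonometric kernel\<close>

text \<open>The binomial theorem applied to
  \<open>((ee (u/2) + ee (- (u/2))) / 2) ^ (2 * J)\<close>. This kernel is nonnegative, has period
  1, peaks at the integers, and has nonnegative Fourier coefficients supported on frequencies of
  size at most \<open>J\<close>.\<close>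

lemma cos_power_expansion:
  "complex_of_real (cos (pi * u) ^ (2 * J)) =
    (\<Sum>i\<le>2*J. of_real (real (2 * J choose i) / 4 ^ J) * ee ((real i - real J) * u))"
proof -
  have "complex_of_real (cos (pi * u)) = (ee (u / 2) + ee (- (u / 2))) / 2"
    by (simp add: ee_def complex_eq_iff)
  then have "complex_of_real (cos (pi * u) ^ (2 * J)) = (ee (u / 2) + ee (- (u / 2))) ^ (2 * J) / 4 ^ J"
    by (simp only: of_real_power power_divide power_mult) simp
  also have "\<dots> = (\<Sum>i\<le>2*J. of_nat (2 * J choose i) * ee (u / 2) ^ i * ee (- (u / 2)) ^ (2 * J - i) / 4 ^ J)"
    unfolding binomial_ring by (simp add: sum_divide_distrib)
  also have "\<dots> = (\<Sum>i\<le>2*J. of_real (real (2 * J choose i) / 4 ^ J) * ee ((real i - real J) * u))"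
  proof (rule sum.cong)
    fix i assume i: "i \<in> {..2*J}"
    have "ee (u / 2) ^ i * ee (- (u / 2)) ^ (2 * J - i) = ee ((real i - real J) * u)"
    proof -
      have "real i * (u / 2) + real (2 * J - i) * - (u / 2) = (real i - real J) * u"
        using i by (simp add: of_nat_diff field_simps)
      then show ?thesis by (simp add: ee_power flip: ee_add)
    qed
    then show "of_nat (2 * J choose i) * ee (u / 2) ^ i * ee (- (u / 2)) ^ (2 * J - i) / 4 ^ J =
        of_real (real (2 * J choose i) / 4 ^ J) * ee ((real i - real J) * u)"
      by (simp add: mult.assoc)
  qed simp
  finally show ?thesis .
qed

lemma sum_central_weights: "(\<Sum>i\<le>2*J. real (2 * J choose i) / 4 ^ J) = 1"
proof -
  have "(\<Sum>i\<le>2*J. real (2 * J choose i)) = real (\<Sum>i\<le>2*J. 2 * J choose i)"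
    by simp
  also have "\<dots> = 4 ^ J"
    unfolding choose_row_sum by (simp add: power_mult)
  finally show ?thesis by (simp flip: sum_divide_distrib)
qed

text \<open>The index \<open>J\<close> belongs to frequency zero, so this bounds the mean of the
  kernel from below.\<close>

lemma central_weight_ge:
  assumes "J > 0"
  shows "1 / (2 * real J) \<le> real (2 * J choose J) / 4 ^ J"
  using central_binomial_lower_bound[OF assms] assms by (simp add: field_simps)

text \<open>The mean of \<open>g\<close> over \<open>S\<close> is \<open>w i0\<close>, at least
  \<open>\<delta>\<close>, plus the other terms, which contribute at most
  \<open>\<delta> / 2\<close> in total because the weights sum to \<open>1\<close>. Some value of
  \<open>g\<close> is at least the mean.\<close>

lemma ex_value_ge_mean:
  fixes g :: "'a \<Rightarrow> real" and z :: "'b \<Rightarrow> 'a \<Rightarrow> complex"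
  assumes "finite S" "S \<noteq> {}" "finite I" "i0 \<in> I"
    and w: "\<And>i. i \<in> I \<Longrightarrow> w i \<ge> 0" "(\<Sum>i\<in>I. w i) = 1" "\<delta> \<le> w i0"
    and g: "\<And>n. n \<in> S \<Longrightarrow> of_real (g n) = (\<Sum>i\<in>I. of_real (w i) * z i n)"
    and z0: "\<And>n. n \<in> S \<Longrightarrow> z i0 n = 1"
    and small: "\<And>i. i \<in> I \<Longrightarrow> i \<noteq> i0 \<Longrightarrow> norm (\<Sum>n\<in>S. z i n) \<le> real (card S) * (\<delta> / 2)"
    and "\<delta> > 0"
  shows "\<exists>n\<in>S. g n \<ge> \<delta> / 2"
proof (rule ccontr)
  assume "\<not> ?thesis"
  then have "(\<Sum>n\<in>S. g n) < (\<Sum>n\<in>S. \<delta> / 2)"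
    using assms by (intro sum_strict_mono) (auto simp: not_le)
  then have upper: "(\<Sum>n\<in>S. g n) < real (card S) * (\<delta> / 2)" by simp
  let ?R = "\<Sum>i\<in>I-{i0}. of_real (w i) * (\<Sum>n\<in>S. z i n)"
  have "complex_of_real (\<Sum>n\<in>S. g n) = (\<Sum>n\<in>S. \<Sum>i\<in>I. of_real (w i) * z i n)"
    using g by simp
  also have "\<dots> = (\<Sum>i\<in>I. of_real (w i) * (\<Sum>n\<in>S. z i n))"
    by (subst sum.swap) (simp add: sum_distrib_left)
  also have "\<dots> = of_real (w i0) * (\<Sum>n\<in>S. z i0 n) + ?R"
    using assms by (simp add: sum.remove)
  also have "(\<Sum>n\<in>S. z i0 n) = of_real (real (card S))"
    using z0 by simp
  finally have "(\<Sum>n\<in>S. g n) = w i0 * real (card S) + Re ?R"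
    by (simp add: complex_eq_iff)
  moreover have "norm ?R \<le> (\<Sum>i\<in>I-{i0}. w i * (real (card S) * (\<delta> / 2)))"
  proof (rule sum_norm_le)
    fix i assume "i \<in> I - {i0}"
    then have "w i \<ge> 0" "norm (\<Sum>n\<in>S. z i n) \<le> real (card S) * (\<delta> / 2)"
      using small w by auto
    then show "norm (of_real (w i) * (\<Sum>n\<in>S. z i n)) \<le> w i * (real (card S) * (\<delta> / 2))"
      by (simp only: norm_mult norm_of_real abs_of_nonneg mult_left_mono)
  qed
  moreover have "\<dots> \<le> (\<Sum>i\<in>I. w i * (real (card S) * (\<delta> / 2)))"
    using assms by (intro sum_mono2) auto
  moreover have "\<dots> = real (card S) * (\<delta> / 2)"
    unfolding sum_distrib_right[symmetric] w by simp
  moreover have "- norm ?R \<le> Re ?R"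
    using abs_Re_le_cmod[of ?R] by linarith
  moreover have "\<delta> * real (card S) \<le> w i0 * real (card S)"
    using w by (intro mult_right_mono) auto
  ultimately show False using upper by (simp add: field_simps)
qed

lemma norm_sum_ee_translate:
  "norm (\<Sum>n\<in>S. ee (x n - c)) = norm (\<Sum>n\<in>S. ee (x n))"
proof -
  have "(\<Sum>n\<in>S. ee (x n - c)) = (\<Sum>n\<in>S. ee (x n)) * ee (- c)"
    by (simp add: sum_distrib_right flip: ee_add)
  then show ?thesis by (simp add: norm_mult)
qed

text \<open>Here \<open>ex_value_ge_mean\<close> is applied to the kernel centred at
  \<open>x0\<close>, with \<open>\<delta> = 1 / (2 * J)\<close>. The centre only multiplies each
  exponential sum by a unimodular constant, so it may be chosen freely.\<close>

lemma ex_cos_power_ge: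
  fixes x :: "'a \<Rightarrow> real"
  assumes S: "finite S" "S \<noteq> {}" and J: "J > 0"
    and small: "\<And>c::int. c \<noteq> 0 \<Longrightarrow> \<bar>c\<bar> \<le> int J \<Longrightarrow>
      norm (\<Sum>n\<in>S. ee (of_int c * x n)) \<le> real (card S) / (4 * real J)"
  shows "\<exists>n\<in>S. 1 / (4 * real J) \<le> cos (pi * (x n - x0)) ^ (2 * J)"
proof -
  have "\<exists>n\<in>S. (1 / (2 * real J)) / 2 \<le> cos (pi * (x n - x0)) ^ (2 * J)"
  proof (rule ex_value_ge_mean[where I = "{..2*J}" and ?i0.0 = J
      and w = "\<lambda>i. real (2 * J choose i) / 4 ^ J"])
    fix i assume i: "i \<in> {..2*J}" "i \<noteq> J"
    have "norm (\<Sum>n\<in>S. ee ((real i - real J) * (x n - x0))) =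
        norm (\<Sum>n\<in>S. ee (of_int (int i - int J) * x n))"
      using norm_sum_ee_translate[of "\<lambda>n. (real i - real J) * x n" "(real i - real J) * x0" S]
      by (simp add: right_diff_distrib)
    also have "\<dots> \<le> real (card S) / (4 * real J)"
      using i by (intro small) auto
    finally show "norm (\<Sum>n\<in>S. ee ((real i - real J) * (x n - x0))) \<le>
        real (card S) * ((1 / (2 * real J)) / 2)" by simp
  next
    show "complex_of_real (cos (pi * (x n - x0)) ^ (2 * J)) =
      (\<Sum>i\<le>2*J. of_real (real (2 * J choose i) / 4 ^ J) * ee ((real i - real J) * (x n - x0)))" for n
      by (rule cos_power_expansion)
  qed (use S J sum_central_weights central_weight_ge in auto)
  then show ?thesis by simp
qed

text \<open>The same argument with a product of two kernels, whose constant coefficient is at least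
  \<open>1 / (4 * J\<^sup>2)\<close>. Both factors lie between \<open>0\<close> and
  \<open>1\<close>, so a lower bound for the product holds for each of them.\<close>

lemma ex_cos_power_ge2:
  fixes x y :: "'a \<Rightarrow> real"
  assumes S: "finite S" "S \<noteq> {}" and J: "J > 0"
    and small: "\<And>b c::int. (b, c) \<noteq> (0, 0) \<Longrightarrow> \<bar>b\<bar> \<le> int J \<Longrightarrow> \<bar>c\<bar> \<le> int J \<Longrightarrow>
      norm (\<Sum>n\<in>S. ee (of_int b * x n + of_int c * y n)) \<le> real (card S) / (8 * (real J)\<^sup>2)"
  shows "\<exists>n\<in>S. 1 / (8 * (real J)\<^sup>2) \<le> cos (pi * (x n - x0)) ^ (2 * J) \<and>
    1 / (8 * (real J)\<^sup>2) \<le> cos (pi * (y n - y0)) ^ (2 * J)"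
proof -
  define w where "w i = real (2 * J choose i) / 4 ^ J" for i
  have "\<exists>n\<in>S. (1 / (4 * (real J)\<^sup>2)) / 2 \<le>
      cos (pi * (x n - x0)) ^ (2 * J) * cos (pi * (y n - y0)) ^ (2 * J)"
  proof (rule ex_value_ge_mean[where I = "{..2*J} \<times> {..2*J}" and ?i0.0 = "(J, J)"
      and w = "\<lambda>(i, j). w i * w j"
      and z = "\<lambda>(i, j) n. ee ((real i - real J) * (x n - x0)) * ee ((real j - real J) * (y n - y0))"])
    fix p assume p: "p \<in> {..2*J} \<times> {..2*J}" "p \<noteq> (J, J)"
    obtain i j where ij: "p = (i, j)" by (cases p)
    have "norm (\<Sum>n\<in>S. ee ((real i - real J) * (x n - x0)) * ee ((real j - real J) * (y n - y0))) =
        norm (\<Sum>n\<in>S. ee (((real i - real J) * x n + (real j - real J) * y n) -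
          ((real i - real J) * x0 + (real j - real J) * y0)))"
      by (simp add: algebra_simps flip: ee_add)
    also have "\<dots> = norm (\<Sum>n\<in>S. ee (of_int (int i - int J) * x n + of_int (int j - int J) * y n))"
      by (subst norm_sum_ee_translate) simp
    also have "\<dots> \<le> real (card S) / (8 * (real J)\<^sup>2)"
      using p ij by (intro small) auto
    finally show "norm (\<Sum>n\<in>S. (case p of (i, j) \<Rightarrow> \<lambda>n. ee ((real i - real J) * (x n - x0)) *
        ee ((real j - real J) * (y n - y0))) n) \<le> real (card S) * ((1 / (4 * (real J)\<^sup>2)) / 2)"
      by (simp add: ij)
  next
    have "(\<Sum>p\<in>{..2*J} \<times> {..2*J}. case p of (i, j) \<Rightarrow> w i * w j) = (\<Sum>i\<le>2*J. w i) * (\<Sum>j\<le>2*J. w j)"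
      by (simp add: sum_product sum.cartesian_product)
    then show "(\<Sum>p\<in>{..2*J} \<times> {..2*J}. case p of (i, j) \<Rightarrow> w i * w j) = 1"
      by (simp add: w_def sum_central_weights)
  next
    have "(1 / (2 * real J)) * (1 / (2 * real J)) \<le> w J * w J"
      unfolding w_def using central_weight_ge[OF J] J by (intro mult_mono) auto
    then show "1 / (4 * (real J)\<^sup>2) \<le> (case (J, J) of (i, j) \<Rightarrow> w i * w j)"
      by (simp add: power2_eq_square)
  next
    fix n
    show "complex_of_real (cos (pi * (x n - x0)) ^ (2 * J) * cos (pi * (y n - y0)) ^ (2 * J)) =
      (\<Sum>p\<in>{..2*J} \<times> {..2*J}. of_real (case p of (i, j) \<Rightarrow> w i * w j) *
        (case p of (i, j) \<Rightarrow> \<lambda>n. ee ((real i - real J) * (x n - x0)) * ee ((real j - real J) * (y n - y0))) n)"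
      unfolding of_real_mult cos_power_expansion w_def[symmetric] sum_product sum.cartesian_product
      by (intro sum.cong) (auto simp: mult_ac)
  qed (use S J in \<open>auto simp: w_def\<close>)
  then obtain n where n: "n \<in> S" and
    prod: "1 / (8 * (real J)\<^sup>2) \<le> cos (pi * (x n - x0)) ^ (2 * J) * cos (pi * (y n - y0)) ^ (2 * J)"
    by auto
  have bounds: "0 \<le> cos u ^ (2 * J)" "cos u ^ (2 * J) \<le> 1" for u :: real
    by (auto simp: power_mult intro!: power_le_one abs_square_le_1[THEN iffD2])
  have "cos (pi * (x n - x0)) ^ (2 * J) * cos (pi * (y n - y0)) ^ (2 * J) \<le> cos (pi * (x n - x0)) ^ (2 * J)"
    "cos (pi * (x n - x0)) ^ (2 * J) * cos (pi * (y n - y0)) ^ (2 * J) \<le> cos (pi * (y n - y0)) ^ (2 * J)"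
    using bounds by (intro mult_right_le_one_le mult_left_le_one_le; simp)+
  with prod n show ?thesis by (meson order_trans)
qed

text \<open>Let \<open>r\<close> be the signed distance from \<open>u\<close> to the nearest
  integer. The kernel equals \<open>(1 - sin\<^sup>2) ^ J \<le> exp (- J * sin\<^sup>2)\<close> at
  \<open>pi * r\<close>, so the assumption forces \<open>J * sin\<^sup>2\<close> to be at most
  logarithmic in \<open>J\<close>. A crude bound for the logarithm and Jordan's inequality then give
  the power of \<open>J\<close>.\<close>

lemma cos_power_ge_imp_near_int:
  fixes u :: real
  assumes J: "J > 0" and large: "1 / (8 * (real J)\<^sup>2) \<le> cos (pi * u) ^ (2 * J)"
  shows "\<exists>k::int. \<bar>u - of_int k\<bar> \<le> real J powr (- 1 / 4)"
proof -
  define r where "r = u - of_int (round u)"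
  have r: "\<bar>r\<bar> \<le> 1 / 2"
    using of_int_round_abs_le[of u] by (simp add: r_def abs_minus_commute)
  have "(cos (pi * u))\<^sup>2 = (cos (pi * r))\<^sup>2"
  proof -
    have "pi * u = pi * r + of_int (round u) * pi" by (simp add: r_def algebra_simps)
    moreover have "sin (of_int (round u) * pi) = 0"
      by (simp add: sin_zero_iff_int2)
    moreover from this have "(cos (of_int (round u) * pi :: real))\<^sup>2 = 1"
      by (simp add: cos_squared_eq)
    ultimately show ?thesis by (simp add: cos_add power_mult_distrib)
  qed
  then have "cos (pi * u) ^ (2 * J) = (1 - (sin (pi * r))\<^sup>2) ^ J"
    by (simp add: power_mult cos_squared_eq)
  also have "\<dots> \<le> exp (- (sin (pi * r))\<^sup>2) ^ J"
    using exp_ge_add_one_self[of "- (sin (pi * r))\<^sup>2"]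
    by (intro power_mono) (auto simp: abs_square_le_1)
  also have "\<dots> = exp (- (real J * (sin (pi * r))\<^sup>2))"
    by (simp flip: exp_of_nat_mult)
  finally have "1 / (8 * (real J)\<^sup>2) \<le> exp (- (real J * (sin (pi * r))\<^sup>2))"
    using large by simp
  then have "exp (real J * (sin (pi * r))\<^sup>2) \<le> 8 * (real J)\<^sup>2"
    using J by (simp add: exp_minus field_simps)
  then have "real J * (sin (pi * r))\<^sup>2 \<le> ln (8 * (real J)\<^sup>2)"
    using J by (simp add: ln_ge_iff)
  \<comment> \<open>Written with \<open>sqrt J\<close>, the logarithm is bounded by
    \<open>ln z \<le> z - 1\<close>: it is at most \<open>3 + 4 * (sqrt J - 1)\<close>.\<close>
  also have "\<dots> = 3 * ln 2 + 4 * ln (sqrt (real J))"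
  proof -
    have "ln (8 * (real J)\<^sup>2) = ln (2 ^ 3 * sqrt (real J) ^ 4)"
      using power_mult[of "sqrt (real J)" 2 2] by simp
    also have "\<dots> = 3 * ln 2 + 4 * ln (sqrt (real J))"
      using J ln_realpow[of 2 3] by (subst ln_mult) (simp_all add: ln_realpow del: ln_sqrt)
    finally show ?thesis .
  qed
  also have "\<dots> \<le> 4 * sqrt (real J)"
    using ln_le_minus_one[of "sqrt (real J)"] ln_le_minus_one[of 2] J by (simp del: ln_sqrt)
  also have "4 * sqrt (real J) = real J * (4 * real J powr (- 1 / 2))"
    using J by (simp add: powr_half_sqrt[symmetric] powr_mult_base)
  finally have "(sin (pi * r))\<^sup>2 \<le> 4 * real J powr (- 1 / 2)"
    by (rule mult_left_le_imp_le) (use J in simp)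
  moreover have "(2 * \<bar>r\<bar>)\<^sup>2 \<le> (sin (pi * r))\<^sup>2"
    using sin_pi_ge[OF r] by (simp only: abs_le_square_iff[symmetric])
  ultimately have "\<bar>r\<bar>\<^sup>2 \<le> (real J powr (- 1 / 4))\<^sup>2"
    by (simp add: power2_eq_square flip: powr_add)
  then have "\<bar>r\<bar> \<le> real J powr (- 1 / 4)"
    by (rule power2_le_imp_le) simp
  then show ?thesis unfolding r_def by blast
qed

section \<open>Pseudo-polynomials\<close>

text \<open>The \<open>m\<close>-th derivative of \<open>pp_eval\<close> on the positive reals in
  closed form; the product is a falling factorial of the exponent.\<close>

definition pp_deriv :: "nat \<Rightarrow> (nat \<Rightarrow> real) \<Rightarrow> (nat \<Rightarrow> real) \<Rightarrow> nat \<Rightarrow> real \<Rightarrow> real" where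
  "pp_deriv d \<alpha> \<theta> m x = (\<Sum>i=1..d. \<alpha> i * (\<Prod>j<m. \<theta> i - real j) * x powr (\<theta> i - real m))"

lemma pp_deriv_0: "pp_deriv d \<alpha> \<theta> 0 = pp_eval d \<alpha> \<theta>"
  by (rule ext) (simp add: pp_deriv_def pp_eval_def)

lemma has_real_derivative_pp_deriv:
  assumes "x > 0"
  shows "(pp_deriv d \<alpha> \<theta> m has_real_derivative pp_deriv d \<alpha> \<theta> (Suc m) x) (at x)"
proof -
  have "((\<lambda>x. \<Sum>i=1..d. \<alpha> i * (\<Prod>j<m. \<theta> i - real j) * x powr (\<theta> i - real m))
      has_real_derivative (\<Sum>i=1..d. \<alpha> i * (\<Prod>j<m. \<theta> i - real j) *
        ((\<theta> i - real m) * x powr (\<theta> i - real m - 1)))) (at x)"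
    by (intro DERIV_sum DERIV_cmult has_real_derivative_powr assms)
  then show ?thesis
    unfolding pp_deriv_def[abs_def] by (simp add: mult_ac diff_diff_eq add.commute)
qed

text \<open>Differentiating more than \<open>\<theta> d\<close> times kills the integral exponents, so that the largest
  non-integral one takes over.\<close>
lemma pp_deriv_asymp:
  assumes m: "m \<in> {1..d}"
    and max: "\<And>i. i \<in> {1..d} \<Longrightarrow> i \<noteq> m \<Longrightarrow> \<theta> i \<notin> \<int> \<Longrightarrow> \<theta> i < \<theta> m"
    and k: "\<And>i. i \<in> {1..d} \<Longrightarrow> 0 \<le> \<theta> i \<and> \<theta> i < real k"
  shows "((\<lambda>x. pp_deriv d \<alpha> \<theta> k x / x powr (\<theta> m - real k)) \<longlongrightarrow>
    \<alpha> m * (\<Prod>j<k. \<theta> m - real j)) at_top"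
proof -
  define p where "p i = \<alpha> i * (\<Prod>j<k. \<theta> i - real j)" for i
  have lim: "((\<lambda>x. p i * x powr (\<theta> i - \<theta> m)) \<longlongrightarrow> (if i = m then p m else 0)) at_top"
    if i: "i \<in> {1..d}" for i
  proof (cases "i = m")
    case True
    have "((\<lambda>x::real. p m) \<longlongrightarrow> p m) at_top" by simp
    moreover have "\<forall>\<^sub>F x in at_top. p m = p i * x powr (\<theta> i - \<theta> m)"
      using eventually_gt_at_top[of "0::real"] by eventually_elim (simp add: True)
    ultimately have "((\<lambda>x. p i * x powr (\<theta> i - \<theta> m)) \<longlongrightarrow> p m) at_top"
      by (rule Lim_transform_eventually)
    then show ?thesis using True by simp
  next
    case False
    show ?thesis
    proof (cases "\<theta> i \<in> \<int>")
      case True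
      \<comment> \<open>An integral exponent below \<open>k\<close> equals one of the
        \<open>j < k\<close>, so its falling factorial contains the factor zero.\<close>
      then obtain z where z: "\<theta> i = of_int z" by (auto elim: Ints_cases)
      then have "\<theta> i = real (nat z)" "nat z < k" using k[OF i] by auto
      then have "(\<Prod>j<k. \<theta> i - real j) = 0" by (auto simp: prod_zero_iff)
      then have "p i = 0" by (simp only: p_def mult_zero_right)
      then show ?thesis using False by simp
    next
      case nonint: False
      have "((\<lambda>x. x powr (\<theta> i - \<theta> m)) \<longlongrightarrow> 0) at_top"
        using max[OF i False nonint] by (intro tendsto_neg_powr filterlim_ident) auto
      then show ?thesis using False by (auto intro: tendsto_mult_right_zero)
    qed
  qed
  have "((\<lambda>x. \<Sum>i=1..d. p i * x powr (\<theta> i - \<theta> m)) \<longlongrightarrow> (\<Sum>i=1..d. if i = m then p m else 0)) at_top"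
    by (intro tendsto_sum lim)
  also have "(\<Sum>i=1..d. if i = m then p m else 0) = p m"
    using m by simp
  finally have "((\<lambda>x. \<Sum>i=1..d. p i * x powr (\<theta> i - \<theta> m)) \<longlongrightarrow> p m) at_top" .
  moreover have "\<forall>\<^sub>F x in at_top. (\<Sum>i=1..d. p i * x powr (\<theta> i - \<theta> m)) =
      pp_deriv d \<alpha> \<theta> k x / x powr (\<theta> m - real k)"
    using eventually_gt_at_top[of 0]
  proof eventually_elim
    case (elim x)
    have "p i * x powr (\<theta> i - \<theta> m) =
        \<alpha> i * (\<Prod>j<k. \<theta> i - real j) * x powr (\<theta> i - real k) / x powr (\<theta> m - real k)" for i
      using elim by (simp only: p_def powr_diff) (simp add: field_simps)
    then show ?case
      by (simp only: pp_deriv_def sum_divide_distrib)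
  qed
  ultimately show ?thesis
    unfolding p_def by (rule Lim_transform_eventually)
qed

lemma eventually_abs_bounds_of_ratio_tendsto:
  fixes f g :: "'a \<Rightarrow> real"
  assumes "((\<lambda>x. f x / g x) \<longlongrightarrow> L) F" "L \<noteq> 0" "\<forall>\<^sub>F x in F. g x > 0"
  shows "\<forall>\<^sub>F x in F. \<bar>L\<bar> / 2 * g x \<le> \<bar>f x\<bar> \<and> \<bar>f x\<bar> \<le> 2 * \<bar>L\<bar> * g x"
proof -
  have lim: "((\<lambda>x. \<bar>f x / g x\<bar>) \<longlongrightarrow> \<bar>L\<bar>) F"
    using assms(1) by (rule tendsto_rabs)
  have "\<forall>\<^sub>F x in F. \<bar>f x / g x\<bar> > \<bar>L\<bar> / 2" "\<forall>\<^sub>F x in F. \<bar>f x / g x\<bar> < 2 * \<bar>L\<bar>"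
    using assms(2) by (intro order_tendstoD[OF lim]; simp)+
  with assms(3) show ?thesis
    by eventually_elim (auto simp: field_simps)
qed

lemma pseudo_poly_exponent_less:
  assumes "pseudo_poly d \<alpha> \<theta>" "i \<in> {1..d}" "j \<in> {1..d}" "i < j"
  shows "\<theta> i < \<theta> j"
  using assms by (simp add: pseudo_poly_def)

lemma pseudo_poly_exponent_ge_1:
  assumes "pseudo_poly d \<alpha> \<theta>" "i \<in> {1..d}"
  shows "1 \<le> \<theta> i"
proof -
  have "\<theta> 1 \<le> \<theta> i"
    using pseudo_poly_exponent_less[OF assms(1), of 1 i] assms(2) by (cases "i = 1") auto
  then show ?thesis using assms(1) by (simp add: pseudo_poly_def)
qed

lemma pseudo_poly_exponent_le_top:
  assumes "pseudo_poly d \<alpha> \<theta>" "i \<in> {1..d}"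
  shows "\<theta> i \<le> \<theta> d"
  using pseudo_poly_exponent_less[OF assms(1), of i d] assms(2) by (cases "i = d") auto

text \<open>The largest non-integral exponent \<open>\<theta> m\<close> plays the role of
  \<open>t\<close> in \<open>exp_sum_power_saving\<close>; the derivatives of orders
  \<open>k\<close> and \<open>k + 1\<close> then have exactly the orders of magnitude required
  there.\<close>

lemma pp_exp_sum_power_saving:
  assumes pp: "pseudo_poly d \<alpha> \<theta>"
  shows "\<exists>s>0. \<exists>\<kappa>>0. s < 1 \<and> (\<forall>\<^sub>F N in sequentially. \<forall>\<beta>.
    real N powr (- s) \<le> \<bar>\<beta>\<bar> \<longrightarrow> \<bar>\<beta>\<bar> \<le> real N powr s \<longrightarrow>
    norm (\<Sum>n=N..<2*N. ee (\<beta> * pp_eval d \<alpha> \<theta> (real n))) \<le> real N powr (1 - \<kappa>))"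
proof -
  note inc = pseudo_poly_exponent_less[OF pp] and ge1 = pseudo_poly_exponent_ge_1[OF pp]
    and le = pseudo_poly_exponent_le_top[OF pp]
  define I where "I = {i \<in> {1..d}. \<theta> i \<notin> \<int>}"
  have I: "finite I" "I \<noteq> {}" using pp by (auto simp: I_def pseudo_poly_def)
  define m where "m = Max I"
  have mI: "m \<in> I" unfolding m_def using I by (rule Max_in)
  then have m: "m \<in> {1..d}" "\<theta> m \<notin> \<int>" by (auto simp: I_def)
  have max: "\<theta> i < \<theta> m" if "i \<in> {1..d}" "i \<noteq> m" "\<theta> i \<notin> \<int>" for i
  proof -
    have "i \<le> m" unfolding m_def using I that by (intro Max_ge) (auto simp: I_def)
    then show ?thesis using inc m that by simp
  qed
  \<comment> \<open>Taking \<open>k > 2 * \<theta> d\<close> ensures both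
    \<open>2 * \<theta> m < k\<close> and that all exponents, in particular the integral ones, lie
    below \<open>k\<close>.\<close>
  define k where "k = nat \<lceil>2 * \<theta> d\<rceil> + 1"
  have k: "2 * \<theta> d < real k" unfolding k_def by linarith
  have "0 \<le> \<theta> i \<and> \<theta> i < real k" if "i \<in> {1..d}" for i
    using ge1[OF that] le[OF that] k by auto
  then have k': "\<forall>i\<in>{1..d}. 0 \<le> \<theta> i \<and> \<theta> i < real k" "\<forall>i\<in>{1..d}. 0 \<le> \<theta> i \<and> \<theta> i < real (Suc k)"
    by force+
  define L where "L k = \<alpha> m * (\<Prod>j<k. \<theta> m - real j)" for k
  have "\<alpha> m > 0" using m pp by (simp add: pseudo_poly_def)
  then have L: "L k \<noteq> 0" for k
    using m by (auto simp: L_def)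
  have bnd: "\<forall>\<^sub>F x in at_top. \<bar>L k\<bar> / 2 * x powr (\<theta> m - real k) \<le> \<bar>pp_deriv d \<alpha> \<theta> k x\<bar> \<and>
      \<bar>pp_deriv d \<alpha> \<theta> k x\<bar> \<le> 2 * \<bar>L k\<bar> * x powr (\<theta> m - real k)"
    if "\<forall>i\<in>{1..d}. 0 \<le> \<theta> i \<and> \<theta> i < real k" for k
  proof (rule eventually_abs_bounds_of_ratio_tendsto)
    show "((\<lambda>x. pp_deriv d \<alpha> \<theta> k x / x powr (\<theta> m - real k)) \<longlongrightarrow> L k) at_top"
      unfolding L_def using m max that by (intro pp_deriv_asymp) auto
    show "\<forall>\<^sub>F x in at_top. 0 < x powr (\<theta> m - real k)"
      using eventually_gt_at_top[of 0] by eventually_elim simp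
  qed (rule L)
  define c2 where "c2 = max (2 * \<bar>L k\<bar>) (2 * \<bar>L (Suc k)\<bar>)"
  show ?thesis
    unfolding pp_deriv_0[symmetric]
  proof (rule exp_sum_power_saving[where D = "pp_deriv d \<alpha> \<theta>"])
    show "0 < \<theta> m" "2 * \<theta> m < real k"
      using ge1[of m] le[of m] k m by auto
    show "0 < \<bar>L k\<bar> / 2" "0 < c2" using L by (auto simp: c2_def less_max_iff_disj)
    show "\<forall>\<^sub>F x in at_top. \<bar>L k\<bar> / 2 * x powr (\<theta> m - real k) \<le> \<bar>pp_deriv d \<alpha> \<theta> k x\<bar>"
      using bnd[OF k'(1)] by eventually_elim auto
    show "\<forall>\<^sub>F x in at_top. \<bar>pp_deriv d \<alpha> \<theta> k x\<bar> \<le> c2 * x powr (\<theta> m - real k)"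
      using bnd[OF k'(1)]
    proof eventually_elim
      case (elim x)
      have "2 * \<bar>L k\<bar> * x powr (\<theta> m - real k) \<le> c2 * x powr (\<theta> m - real k)"
        by (intro mult_right_mono) (auto simp: c2_def)
      then show ?case using elim by linarith
    qed
    show "\<forall>\<^sub>F x in at_top. \<bar>pp_deriv d \<alpha> \<theta> (Suc k) x\<bar> \<le> c2 * x powr (\<theta> m - real (Suc k))"
      using bnd[OF k'(2)]
    proof eventually_elim
      case (elim x)
      have "2 * \<bar>L (Suc k)\<bar> * x powr (\<theta> m - real (Suc k)) \<le> c2 * x powr (\<theta> m - real (Suc k))"
        by (intro mult_right_mono) (auto simp: c2_def)
      then show ?case using elim by linarith
    qed
  qed (auto intro: has_real_derivative_pp_deriv)
qed

section \<open>Values close to integers\<close>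

lemma eventually_const_mult_powr_le:
  assumes "b < a"
  shows "\<forall>\<^sub>F N in sequentially. K * real N powr (- a) \<le> real N powr (- b)"
proof -
  have "a - b > 0" using assms by simp
  then have "\<forall>\<^sub>F N in sequentially. K \<le> real N powr (a - b)"
    by real_asymp
  then show ?thesis
  proof eventually_elim
    case (elim N)
    then have "K * real N powr (- a) \<le> real N powr (a - b) * real N powr (- a)"
      by (intro mult_right_mono) auto
    then show ?case by (simp flip: powr_add)
  qed
qed

text \<open>Divisibility by \<open>b\<close> means that \<open>f n / b\<close> lies in
  \<open>[0, 1 / b)\<close> modulo 1. It suffices to come closer than \<open>1 / (2 * b)\<close> to
  the midpoint, where the kernel is therefore centred.\<close>

lemma eventually_ex_dvd_floor:
  fixes f :: "real \<Rightarrow> real"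
  assumes \<mu>: "\<mu> > 0" "16 * \<mu> \<le> s" "16 * \<mu> \<le> \<kappa>"
    and expsum: "\<forall>\<^sub>F N in sequentially. \<forall>\<beta>. real N powr (- s) \<le> \<bar>\<beta>\<bar> \<longrightarrow> \<bar>\<beta>\<bar> \<le> real N powr s \<longrightarrow>
      norm (\<Sum>n=N..<2*N. ee (\<beta> * f (real n))) \<le> real N powr (1 - \<kappa>)"
  shows "\<forall>\<^sub>F N in sequentially. \<forall>b::nat. 1 \<le> b \<longrightarrow> real b \<le> real N powr \<mu> \<longrightarrow>
    (\<exists>n\<in>{N..<2*N}. int b dvd \<lfloor>f (real n)\<rfloor>)"
proof -
  have "\<forall>\<^sub>F N in sequentially. 4 * 2 powr (1 / 4) * real N powr (- (2 * \<mu>)) \<le> real N powr (- \<mu>)"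
    using \<mu> by (intro eventually_const_mult_powr_le) auto
  moreover have "\<forall>\<^sub>F N in sequentially. 4 \<le> real N powr (8 * \<mu>)"
    using \<mu> by real_asymp
  moreover have "\<forall>\<^sub>F N in sequentially. 1 \<le> real N"
    by real_asymp
  ultimately show ?thesis using expsum
  proof eventually_elim
    case (elim N)
    show ?case
    proof (intro allI impI)
      fix b :: nat assume b: "1 \<le> b" "real b \<le> real N powr \<mu>"
      \<comment> \<open>The kernel resolves distances \<open>J powr (- 1 / 4)\<close>, of order
        \<open>N powr (- 2 * \<mu>)\<close>, which is finer than
        \<open>1 / b \<ge> N powr (- \<mu>)\<close>. The frequencies \<open>c / b\<close> lie
        between \<open>N powr (- \<mu>)\<close> and \<open>N powr (8 * \<mu>)\<close>.\<close>
      define J where "J = nat \<lfloor>real N powr (8 * \<mu>)\<rfloor>"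
      have J: "J > 0" "real J \<le> real N powr (8 * \<mu>)" "real N powr (8 * \<mu>) / 2 \<le> real J"
        using elim(2) unfolding J_def by linarith+
      have "\<exists>n\<in>{N..<2*N}. 1 / (4 * real J) \<le> cos (pi * (f (real n) / real b - 1 / (2 * real b))) ^ (2 * J)"
      proof (rule ex_cos_power_ge)
        fix c :: int assume c: "c \<noteq> 0" "\<bar>c\<bar> \<le> int J"
        define \<beta> where "\<beta> = of_int c / real b"
        have c': "1 \<le> \<bar>real_of_int c\<bar>" "\<bar>real_of_int c\<bar> \<le> real J" using c by linarith+
        have "norm (\<Sum>n=N..<2*N. ee (\<beta> * f (real n))) \<le> real N powr (1 - \<kappa>)"
        proof (rule elim(4)[rule_format])
          have "real N powr (- s) \<le> real N powr (- \<mu>)"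
            using elim(3) \<mu> by (intro powr_mono) auto
          also have "\<dots> = 1 / real N powr \<mu>" by (simp add: powr_minus_divide)
          also have "\<dots> \<le> 1 / real b" using b by (simp add: frac_le)
          also have "\<dots> \<le> \<bar>\<beta>\<bar>"
            using c' b by (simp add: \<beta>_def abs_divide divide_right_mono)
          finally show "real N powr (- s) \<le> \<bar>\<beta>\<bar>" .
          have "\<bar>\<beta>\<bar> \<le> \<bar>real_of_int c\<bar> / 1"
            unfolding \<beta>_def abs_divide using b by (intro divide_left_mono) auto
          also have "\<dots> \<le> real N powr (8 * \<mu>)" using c' J by simp
          also have "\<dots> \<le> real N powr s" using elim(3) \<mu> by (intro powr_mono) auto
          finally show "\<bar>\<beta>\<bar> \<le> real N powr s" .
        qed
        also have "\<dots> \<le> real N powr (1 - 16 * \<mu>)"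
          using elim(3) \<mu> by (intro powr_mono) auto
        also have "\<dots> = real N / (real N powr (8 * \<mu>) * real N powr (8 * \<mu>))"
          using elim(3) by (simp add: powr_diff flip: powr_add)
        also have "\<dots> \<le> real N / (4 * real J)"
          using elim(2) J by (intro frac_le mult_mono) auto
        finally show "norm (\<Sum>n=N..<2*N. ee (of_int c * (f (real n) / real b))) \<le>
            real (card {N..<2*N}) / (4 * real J)"
          by (simp add: \<beta>_def)
      qed (use elim(3) J in auto)
      then obtain n where n: "n \<in> {N..<2*N}" and
        "1 / (4 * real J) \<le> cos (pi * (f (real n) / real b - 1 / (2 * real b))) ^ (2 * J)"
        by blast
      moreover have "1 / (8 * (real J)\<^sup>2) \<le> 1 / (4 * real J)"
        using J by (simp add: field_simps power2_eq_square)
      ultimately have "1 / (8 * (real J)\<^sup>2) \<le> cos (pi * (f (real n) / real b - 1 / (2 * real b))) ^ (2 * J)"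
        by linarith
      then obtain q :: int where q: "\<bar>f (real n) / real b - 1 / (2 * real b) - of_int q\<bar> \<le> real J powr (- 1 / 4)"
        using cos_power_ge_imp_near_int[OF J(1)] by blast
      also have "\<dots> \<le> (real N powr (8 * \<mu>) / 2) powr (- 1 / 4)"
        using J elim(2,3) by (intro powr_mono2') auto
      also have "\<dots> = 2 powr (1 / 4) * real N powr (- (2 * \<mu>))"
        by (simp add: powr_divide powr_powr powr_minus_divide)
      also have "\<dots> \<le> real N powr (- \<mu>) / 4" using elim(1) by simp
      \<comment> \<open>Strictness places \<open>f n\<close> inside the open interval from
        \<open>b * q\<close> to \<open>b * q + 1\<close>, so its floor is exactly
        \<open>b * q\<close>.\<close>
      also have "\<dots> < 1 / (2 * real N powr \<mu>)"
        using elim(3) by (simp add: powr_minus field_simps)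
      also have "\<dots> \<le> 1 / (2 * real b)"
        using b by (intro frac_le mult_left_mono) auto
      finally have "real b * \<bar>f (real n) / real b - 1 / (2 * real b) - of_int q\<bar> < real b * (1 / (2 * real b))"
        using b by (intro mult_strict_left_mono) auto
      moreover have "real b * \<bar>f (real n) / real b - 1 / (2 * real b) - of_int q\<bar> =
          \<bar>f (real n) - 1 / 2 - real b * of_int q\<bar>"
      proof -
        have "real b * \<bar>f (real n) / real b - 1 / (2 * real b) - of_int q\<bar> =
            \<bar>real b * (f (real n) / real b - 1 / (2 * real b) - of_int q)\<bar>"
          by (simp add: abs_mult)
        also have "real b * (f (real n) / real b - 1 / (2 * real b) - of_int q) =
            f (real n) - 1 / 2 - real b * of_int q"
          using b by (simp add: right_diff_distrib)
        finally show ?thesis .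
      qed
      ultimately have "\<bar>f (real n) - 1 / 2 - real b * of_int q\<bar> < 1 / 2"
        using b by simp
      then have "real b * of_int q \<le> f (real n)" "f (real n) < real b * of_int q + 1"
        by linarith+
      then have "\<lfloor>f (real n)\<rfloor> = int b * q"
        by (intro floor_unique) simp_all
      then have "int b dvd \<lfloor>f (real n)\<rfloor>" by simp
      then show "\<exists>n\<in>{N..<2*N}. int b dvd \<lfloor>f (real n)\<rfloor>" using n by blast
    qed
  qed
qed

text \<open>The hypothesis on \<open>\<xi>\<close> puts every frequency \<open>b + c * \<xi>\<close>
  of the two-dimensional kernel into the range of \<open>expsum\<close>. Hence some
  \<open>f n\<close> lies just above an integer while \<open>\<xi> * f n\<close> is near an integer,
  and replacing \<open>f n\<close> by its floor changes little.\<close>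

lemma eventually_ex_near_int_of_not_near_rational:
  fixes f :: "real \<Rightarrow> real"
  assumes \<mu>: "\<mu> > 0" "16 * \<mu> \<le> s" "16 * \<mu> \<le> \<kappa>"
    and expsum: "\<forall>\<^sub>F N in sequentially. \<forall>\<beta>. real N powr (- s) \<le> \<bar>\<beta>\<bar> \<longrightarrow> \<bar>\<beta>\<bar> \<le> real N powr s \<longrightarrow>
      norm (\<Sum>n=N..<2*N. ee (\<beta> * f (real n))) \<le> real N powr (1 - \<kappa>)"
  shows "\<forall>\<^sub>F N in sequentially. \<forall>\<xi> J. 0 \<le> \<xi> \<longrightarrow> \<xi> \<le> 1 \<longrightarrow> 17 \<le> J \<longrightarrow> real J \<le> real N powr \<mu> \<longrightarrow>
    (\<forall>(b::nat) (a::int). 1 \<le> b \<longrightarrow> b \<le> J \<longrightarrow> real N powr (- s) \<le> \<bar>of_int a + real b * \<xi>\<bar>) \<longrightarrow>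
    (\<exists>n\<in>{N..<2*N}. \<exists>m::int. \<bar>\<xi> * of_int \<lfloor>f (real n)\<rfloor> - of_int m\<bar> \<le> 3 * real J powr (- 1 / 4))"
proof -
  have "\<forall>\<^sub>F N in sequentially. 8 \<le> real N powr \<mu>"
    using \<mu> by real_asymp
  moreover have "\<forall>\<^sub>F N in sequentially. 1 \<le> real N"
    by real_asymp
  ultimately show ?thesis using expsum
  proof eventually_elim
    case (elim N)
    show ?case
    proof (intro allI impI)
      fix \<xi> :: real and J :: nat
      assume \<xi>: "0 \<le> \<xi>" "\<xi> \<le> 1" and J: "17 \<le> J" "real J \<le> real N powr \<mu>"
        and far: "\<forall>(b::nat) (a::int). 1 \<le> b \<longrightarrow> b \<le> J \<longrightarrow> real N powr (- s) \<le> \<bar>of_int a + real b * \<xi>\<bar>"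
      \<comment> \<open>The resolution of the kernel. From \<open>J \<ge> 17\<close> it is less than
        \<open>1 / 2\<close>, so an interval \<open>[q, q + 2 * \<epsilon>]\<close> stays below
        \<open>q + 1\<close>.\<close>
      define \<epsilon> where "\<epsilon> = real J powr (- 1 / 4)"
      have "\<epsilon> < (16::real) powr (- 1 / 4)"
        unfolding \<epsilon>_def using J by (intro powr_less_mono2_neg) auto
      also have "(16::real) powr (- 1 / 4) = (2 powr 4) powr (- 1 / 4)" by simp
      also have "\<dots> = 1 / 2" unfolding powr_powr by (simp add: powr_minus)
      finally have \<epsilon>: "\<epsilon> < 1 / 2" .
      \<comment> \<open>The hypothesis concerns positive multiples of \<open>\<xi>\<close>. For
        \<open>c = 0\<close> the frequency is a nonzero integer, and \<open>c < 0\<close> is reduced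
        to it by a change of sign.\<close>
      have lower: "real N powr (- s) \<le> \<bar>of_int b + of_int c * \<xi>\<bar>"
        if bc: "(b, c) \<noteq> (0, 0)" "\<bar>c\<bar> \<le> int J" for b c :: int
      proof -
        consider "c = 0" | "c > 0" | "c < 0" by linarith
        then show ?thesis
        proof cases
          case 1
          then have "b \<noteq> 0" using bc by simp
          then have "1 \<le> \<bar>real_of_int b\<bar>" by linarith
          moreover have "real N powr (- s) \<le> 1"
            using elim(2) \<mu> powr_mono[of "- s" 0 "real N"] by simp
          ultimately show ?thesis using 1 by simp
        next
          case 2
          then show ?thesis using far[rule_format, of "nat c" b] bc by auto
        next
          case 3
          then have "real N powr (- s) \<le> \<bar>of_int (- b) + real (nat (- c)) * \<xi>\<bar>"
            using bc by (intro far[rule_format]) auto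
          also have "of_int (- b) + real (nat (- c)) * \<xi> = - (of_int b + of_int c * \<xi>)"
            using 3 by simp
          finally show ?thesis by simp
        qed
      qed
      \<comment> \<open>The kernel for \<open>f n\<close> is centred at \<open>\<epsilon>\<close>
        rather than \<open>0\<close>, so that its window of radius \<open>\<epsilon>\<close> starts
        at an integer and the floor is known.\<close>
      have "\<exists>n\<in>{N..<2*N}. 1 / (8 * (real J)\<^sup>2) \<le> cos (pi * (f (real n) - \<epsilon>)) ^ (2 * J) \<and>
          1 / (8 * (real J)\<^sup>2) \<le> cos (pi * (\<xi> * f (real n) - 0)) ^ (2 * J)"
      proof (rule ex_cos_power_ge2)
        fix b c :: int assume bc: "(b, c) \<noteq> (0, 0)" "\<bar>b\<bar> \<le> int J" "\<bar>c\<bar> \<le> int J"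
        have "norm (\<Sum>n=N..<2*N. ee ((of_int b + of_int c * \<xi>) * f (real n))) \<le> real N powr (1 - \<kappa>)"
        proof (rule elim(3)[rule_format])
          show "real N powr (- s) \<le> \<bar>of_int b + of_int c * \<xi>\<bar>" using lower bc by blast
          have bc': "\<bar>real_of_int b\<bar> \<le> real J" "\<bar>real_of_int c\<bar> \<le> real J"
            using bc by linarith+
          have "\<bar>of_int b + of_int c * \<xi>\<bar> \<le> \<bar>real_of_int b\<bar> + \<bar>real_of_int c\<bar> * \<xi>"
            using abs_triangle_ineq[of "real_of_int b" "of_int c * \<xi>"] \<xi> by (simp add: abs_mult)
          also have "\<dots> \<le> real J + real J * 1"
            using \<xi> bc'(2) by (intro add_mono bc' mult_mono) auto
          also have "\<dots> \<le> real N powr \<mu> * real N powr \<mu>"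
            using J elim(1) mult_right_mono[of 2 "real N powr \<mu>" "real N powr \<mu>"] by linarith
          also have "\<dots> = real N powr (2 * \<mu>)" by (simp flip: powr_add)
          also have "\<dots> \<le> real N powr s" using elim(2) \<mu> by (intro powr_mono) auto
          finally show "\<bar>of_int b + of_int c * \<xi>\<bar> \<le> real N powr s" .
        qed
        also have "\<dots> \<le> real N powr (1 - 3 * \<mu>)"
          using elim(2) \<mu> by (intro powr_mono) auto
        also have "\<dots> = real N / (real N powr \<mu> * (real N powr \<mu>)\<^sup>2)"
          using elim(2) by (simp add: powr_diff power2_eq_square flip: powr_add)
        also have "\<dots> \<le> real N / (8 * (real J)\<^sup>2)"
          using elim(1) J by (intro frac_le mult_mono power_mono) auto
        finally show "norm (\<Sum>n=N..<2*N. ee (of_int b * f (real n) + of_int c * (\<xi> * f (real n)))) \<le>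
            real (card {N..<2*N}) / (8 * (real J)\<^sup>2)"
          by (simp add: algebra_simps)
      qed (use elim(2) J in auto)
      then obtain n where n: "n \<in> {N..<2*N}"
        and "1 / (8 * (real J)\<^sup>2) \<le> cos (pi * (f (real n) - \<epsilon>)) ^ (2 * J)"
          "1 / (8 * (real J)\<^sup>2) \<le> cos (pi * (\<xi> * f (real n))) ^ (2 * J)"
        by auto
      moreover have "J > 0" using J by simp
      ultimately obtain q m :: int where q: "\<bar>f (real n) - \<epsilon> - of_int q\<bar> \<le> \<epsilon>"
        and m: "\<bar>\<xi> * f (real n) - of_int m\<bar> \<le> \<epsilon>"
        unfolding \<epsilon>_def using cos_power_ge_imp_near_int by metis
      have "\<lfloor>f (real n)\<rfloor> = q"
        using q \<epsilon> by (intro floor_unique) (auto simp: abs_le_iff)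
      then have "\<bar>\<xi> * of_int \<lfloor>f (real n)\<rfloor> - of_int m\<bar> =
          \<bar>(\<xi> * f (real n) - of_int m) - \<xi> * (f (real n) - of_int q)\<bar>"
        by (simp add: algebra_simps)
      also have "\<dots> \<le> \<bar>\<xi> * f (real n) - of_int m\<bar> + \<bar>\<xi> * (f (real n) - of_int q)\<bar>"
        by (rule abs_triangle_ineq4)
      also have "\<dots> \<le> \<epsilon> + 1 * (2 * \<epsilon>)"
        unfolding abs_mult using m q \<xi> by (intro add_mono mult_mono) auto
      finally have "\<bar>\<xi> * of_int \<lfloor>f (real n)\<rfloor> - of_int m\<bar> \<le> 3 * real J powr (- 1 / 4)"
        by (simp add: \<epsilon>_def)
      then show "\<exists>n\<in>{N..<2*N}. \<exists>m::int. \<bar>\<xi> * of_int \<lfloor>f (real n)\<rfloor> - of_int m\<bar> \<le> 3 * real J powr (- 1 / 4)"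
        using n by blast
    qed
  qed
qed

text \<open>If \<open>\<xi>\<close> is not near a fraction with denominator at most
  \<open>J\<close>, a suitable \<open>n\<close> exists at scale \<open>N1\<close>. Otherwise
  \<open>\<bar>a + b * \<xi>\<bar>\<close> is tiny, and an \<open>n\<close> at the much smaller
  scale \<open>N2\<close> with \<open>\<lfloor>f n\<rfloor> = b * q\<close> leaves only the error
  \<open>(a + b * \<xi>) * q\<close>.\<close>

lemma eventually_ex_near_int_floor:
  fixes f :: "real \<Rightarrow> real"
  assumes s: "0 < s" "s < 1" and "0 < \<kappa>"
    and expsum: "\<forall>\<^sub>F N in sequentially. \<forall>\<beta>. real N powr (- s) \<le> \<bar>\<beta>\<bar> \<longrightarrow> \<bar>\<beta>\<bar> \<le> real N powr s \<longrightarrow>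
      norm (\<Sum>n=N..<2*N. ee (\<beta> * f (real n))) \<le> real N powr (1 - \<kappa>)"
    and A: "A > 0" and T: "T \<ge> 1"
    and growth: "\<And>x. x \<ge> 1 \<Longrightarrow> 0 \<le> f x \<and> f x \<le> A * x powr T"
  shows "\<exists>\<eta>>0. \<forall>\<^sub>F N in sequentially. \<forall>\<xi>. 0 \<le> \<xi> \<longrightarrow> \<xi> \<le> 1 \<longrightarrow>
    (\<exists>n\<in>{1..N}. \<exists>m::int. \<bar>\<xi> * of_int \<lfloor>f (real n)\<rfloor> - of_int m\<bar> \<le> real N powr (- \<eta>))"
proof -
  define \<mu> where "\<mu> = min s \<kappa> / 16"
  have \<mu>: "\<mu> > 0" "16 * \<mu> \<le> s" "16 * \<mu> \<le> \<kappa>"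
    using s \<open>0 < \<kappa>\<close> by (auto simp: \<mu>_def)
  \<comment> \<open>At scale \<open>N1 powr \<tau>\<close> the values of \<open>f\<close> have order
    at most \<open>N1 powr (s / 2)\<close>, half the gain \<open>N1 powr (- s)\<close> available
    near a fraction.\<close>
  define \<tau> where "\<tau> = s / (2 * T)"
  have \<tau>: "\<tau> > 0" "\<tau> \<le> 1" "\<tau> * T = s / 2"
    using s T by (auto simp: \<tau>_def field_simps)
  \<comment> \<open>The two cases save \<open>s / 2\<close> and, since
    \<open>J powr (- 1 / 4)\<close> has order \<open>N powr (- \<tau> * \<mu> / 4)\<close>, also
    \<open>\<tau> * \<mu> / 4\<close>. Half of each is spent on constants.\<close>
  define \<eta> where "\<eta> = min (s / 4) (\<tau> * \<mu> / 8)"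
  have \<eta>: "\<eta> > 0" "\<eta> \<le> s / 4" "\<eta> \<le> \<tau> * \<mu> / 8"
    using s \<tau> \<mu> by (auto simp: \<eta>_def)
  \<comment> \<open>Halving keeps \<open>2 * N1 N \<le> N\<close>. \<open>J\<close> is tied to
    \<open>N2\<close> because every denominator \<open>b \<le> J N\<close> must be admissible for
    the divisibility argument at that smaller scale.\<close>
  define N1 N2 J :: "nat \<Rightarrow> nat"
    where "N1 = (\<lambda>N. N div 2)" and "N2 = (\<lambda>N. nat \<lfloor>real (N1 N) powr \<tau>\<rfloor>)"
      and "J = (\<lambda>N. nat \<lfloor>real (N2 N) powr \<mu>\<rfloor>)"
  have N1: "real N / 4 \<le> real (N1 N)" if "N \<ge> 2" for N
    using that unfolding N1_def by linarith
  have floor_half: "x / 2 \<le> real (nat \<lfloor>x\<rfloor>)" "real (nat \<lfloor>x\<rfloor>) \<le> x" if "x \<ge> 1" for x :: real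
  proof -
    have "1 \<le> \<lfloor>x\<rfloor>" using that by simp
    then show "x / 2 \<le> real (nat \<lfloor>x\<rfloor>)" "real (nat \<lfloor>x\<rfloor>) \<le> x" by linarith+
  qed
  have tendsto_N1: "filterlim N1 sequentially sequentially"
    unfolding N1_def filterlim_at_top
  proof
    fix Z
    show "\<forall>\<^sub>F N in sequentially. Z \<le> N div 2"
      using eventually_ge_at_top[of "2 * Z"] by eventually_elim linarith
  qed
  have "filterlim (\<lambda>n. nat \<lfloor>real n powr \<tau>\<rfloor>) sequentially sequentially"
    using \<tau> by real_asymp
  then have tendsto_N2: "filterlim N2 sequentially sequentially"
    unfolding N2_def using tendsto_N1 by (rule filterlim_compose)
  have ev_N1: "\<forall>\<^sub>F N in sequentially. P (N1 N)" if "\<forall>\<^sub>F N in sequentially. P N" for P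
    using that tendsto_N1 by (rule eventually_compose_filterlim)
  have ev_N2: "\<forall>\<^sub>F N in sequentially. P (N2 N)" if "\<forall>\<^sub>F N in sequentially. P N" for P
    using that tendsto_N2 by (rule eventually_compose_filterlim)
  note dvd = ev_N2[OF eventually_ex_dvd_floor[OF \<mu> expsum]]
  note far = ev_N1[OF eventually_ex_near_int_of_not_near_rational[OF \<mu> expsum]]
  have "\<forall>\<^sub>F n in sequentially. 17 \<le> nat \<lfloor>real n powr \<mu>\<rfloor>"
    using \<mu> by real_asymp
  note J17 = ev_N2[OF this]
  have "\<forall>\<^sub>F N in sequentially.
      (A * 2 powr T * 4 powr (s / 2)) * real N powr (- (s / 2)) \<le> real N powr (- (s / 4))"
    using s by (intro eventually_const_mult_powr_le) auto
  then have "\<forall>\<^sub>F N in sequentially. A * 2 powr T * (real N / 4) powr (- (s / 2)) \<le> real N powr (- (s / 4))"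
    by eventually_elim (simp add: powr_divide powr_minus field_simps)
  moreover have "\<forall>\<^sub>F N in sequentially.
      3 * (((real N / 4) powr \<tau> / 2) powr \<mu> / 2) powr (- 1 / 4) \<le> real N powr (- (\<tau> * \<mu> / 8))"
  proof -
    have "\<forall>\<^sub>F N in sequentially. 3 * (4 powr (\<tau> * \<mu> / 4) * 2 powr (\<mu> / 4) * 2 powr (1 / 4)) *
        real N powr (- (\<tau> * \<mu> / 4)) \<le> real N powr (- (\<tau> * \<mu> / 8))"
      using \<tau> \<mu> by (intro eventually_const_mult_powr_le) auto
    then show ?thesis
      by eventually_elim (simp add: powr_divide powr_mult powr_powr powr_minus field_simps)
  qed
  moreover have "\<forall>\<^sub>F N in sequentially. 1 \<le> N2 N"
    by (rule ev_N2) (rule eventually_ge_at_top)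
  moreover have "\<forall>\<^sub>F N in sequentially. 2 \<le> (N::nat)"
    by (rule eventually_ge_at_top)
  ultimately have "\<forall>\<^sub>F N in sequentially. \<forall>\<xi>. 0 \<le> \<xi> \<longrightarrow> \<xi> \<le> 1 \<longrightarrow>
    (\<exists>n\<in>{1..N}. \<exists>m::int. \<bar>\<xi> * of_int \<lfloor>f (real n)\<rfloor> - of_int m\<bar> \<le> real N powr (- \<eta>))"
    using dvd far J17
  proof eventually_elim
    case (elim N)
    note N = elim(4)
    have "1 \<le> N1 N" using N by (simp add: N1_def div_greater_zero_iff Suc_le_eq)
    then have N1_ge: "1 \<le> real (N1 N)" "real N / 4 \<le> real (N1 N)"
      using N1[OF N] by simp_all
    have "1 \<le> real (N1 N) powr \<tau>" using N1_ge \<tau> by (simp add: ge_one_powr_ge_zero)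
    from floor_half[OF this] have N2: "real (N1 N) powr \<tau> / 2 \<le> real (N2 N)" "real (N2 N) \<le> real (N1 N) powr \<tau>"
      unfolding N2_def .
    have "1 \<le> real (N2 N) powr \<mu>" using elim(3) \<mu> by (simp add: ge_one_powr_ge_zero)
    from floor_half[OF this] have J: "real (N2 N) powr \<mu> / 2 \<le> real (J N)" "real (J N) \<le> real (N2 N) powr \<mu>"
      unfolding J_def .
    have "real (N2 N) \<le> real (N1 N)"
      using N2 N1_ge \<tau> powr_mono[of \<tau> 1 "real (N1 N)"] by simp
    then have N21: "N2 N \<le> N1 N" by simp
    show ?case
    proof (intro allI impI)
      fix \<xi> :: real assume \<xi>: "0 \<le> \<xi>" "\<xi> \<le> 1"
      show "\<exists>n\<in>{1..N}. \<exists>m::int. \<bar>\<xi> * of_int \<lfloor>f (real n)\<rfloor> - of_int m\<bar> \<le> real N powr (- \<eta>)"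
      proof (cases "\<forall>(b::nat) (a::int). 1 \<le> b \<longrightarrow> b \<le> J N \<longrightarrow>
          real (N1 N) powr (- s) \<le> \<bar>of_int a + real b * \<xi>\<bar>")
        case True
        have "real (J N) \<le> real (N1 N) powr \<mu>"
          using J(2) powr_mono2[of \<mu> "real (N2 N)" "real (N1 N)"] N21 \<mu> by simp
        moreover have "17 \<le> J N" using elim(7) by (simp add: J_def)
        ultimately obtain n and m :: int where n: "n \<in> {N1 N..<2 * N1 N}"
          and "\<bar>\<xi> * of_int \<lfloor>f (real n)\<rfloor> - of_int m\<bar> \<le> 3 * real (J N) powr (- 1 / 4)"
          using elim(6) \<xi> True by blast
        note this(2)
        also have "3 * real (J N) powr (- 1 / 4) \<le> 3 * (((real N / 4) powr \<tau> / 2) powr \<mu> / 2) powr (- 1 / 4)"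
        proof (intro mult_left_mono powr_mono2')
          have "(real N / 4) powr \<tau> / 2 \<le> real (N1 N) powr \<tau> / 2"
            using N1_ge \<tau> by (intro divide_right_mono powr_mono2) auto
          also have "\<dots> \<le> real (N2 N)" by (rule N2)
          finally have "((real N / 4) powr \<tau> / 2) powr \<mu> / 2 \<le> real (N2 N) powr \<mu> / 2"
            using \<mu> by (intro divide_right_mono powr_mono2) auto
          also have "\<dots> \<le> real (J N)" by (rule J)
          finally show "((real N / 4) powr \<tau> / 2) powr \<mu> / 2 \<le> real (J N)" .
        qed (use N in auto)
        also have "\<dots> \<le> real N powr (- (\<tau> * \<mu> / 8))" by (rule elim(2))
        also have "\<dots> \<le> real N powr (- \<eta>)" using N \<eta> by (intro powr_mono) auto
        finally have "\<bar>\<xi> * of_int \<lfloor>f (real n)\<rfloor> - of_int m\<bar> \<le> real N powr (- \<eta>)" .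
        moreover have "n \<in> {1..N}" using n N by (auto simp: N1_def)
        ultimately show ?thesis by blast
      next
        case False
        then obtain b :: nat and a :: int where b: "1 \<le> b" "b \<le> J N"
          and ab: "\<bar>of_int a + real b * \<xi>\<bar> < real (N1 N) powr (- s)"
          by (auto simp: not_le)
        have "real b \<le> real (N2 N) powr \<mu>" using b J by simp
        then obtain n where n: "n \<in> {N2 N..<2 * N2 N}" and "int b dvd \<lfloor>f (real n)\<rfloor>"
          using elim(5) b by blast
        then obtain q where q: "\<lfloor>f (real n)\<rfloor> = int b * q" by blast
        have n1: "real n \<ge> 1" using n elim(3) by simp
        note f = growth[OF n1]
        have "\<bar>real_of_int q\<bar> \<le> real b * \<bar>real_of_int q\<bar>"
          using b by (simp add: mult_le_cancel_right1)
        also have "\<dots> = \<bar>real_of_int \<lfloor>f (real n)\<rfloor>\<bar>" by (simp add: q abs_mult)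
        also have "\<dots> \<le> f (real n)" using f by simp
        also have "\<dots> \<le> A * real n powr T" using f by simp
        also have "\<dots> \<le> A * (2 * real (N2 N)) powr T"
          using n A T by (intro mult_left_mono powr_mono2) auto
        also have "\<dots> \<le> A * (2 * real (N1 N) powr \<tau>) powr T"
          using N2 A T by (intro mult_left_mono powr_mono2) auto
        also have "\<dots> = A * 2 powr T * real (N1 N) powr (s / 2)"
          by (simp add: powr_mult powr_powr \<tau>(3))
        finally have q_le: "\<bar>real_of_int q\<bar> \<le> A * 2 powr T * real (N1 N) powr (s / 2)" .
        have "\<xi> * of_int \<lfloor>f (real n)\<rfloor> - of_int (- a * q) = (of_int a + real b * \<xi>) * of_int q"
          by (simp add: q algebra_simps)
        then have "\<bar>\<xi> * of_int \<lfloor>f (real n)\<rfloor> - of_int (- a * q)\<bar> =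
            \<bar>of_int a + real b * \<xi>\<bar> * \<bar>real_of_int q\<bar>"
          by (simp only: abs_mult)
        also have "\<dots> \<le> real (N1 N) powr (- s) * (A * 2 powr T * real (N1 N) powr (s / 2))"
          using ab q_le by (intro mult_mono) auto
        also have "\<dots> = A * 2 powr T * real (N1 N) powr (- (s / 2))"
          by (simp flip: powr_add)
        also have "\<dots> \<le> A * 2 powr T * (real N / 4) powr (- (s / 2))"
          using N1_ge N s A by (intro mult_left_mono powr_mono2') auto
        also have "\<dots> \<le> real N powr (- (s / 4))" by (rule elim(1))
        also have "\<dots> \<le> real N powr (- \<eta>)" using N \<eta> by (intro powr_mono) auto
        finally have "\<bar>\<xi> * of_int \<lfloor>f (real n)\<rfloor> - of_int (- a * q)\<bar> \<le> real N powr (- \<eta>)" .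
        moreover have "n \<in> {1..N}" using n N21 elim(3) by (auto simp: N1_def)
        ultimately show ?thesis by blast
      qed
    qed
  qed
  then show ?thesis using \<eta> by blast
qed

section \<open>Distance to the nearest integer and reduction to \<open>\<xi>\<close> in the unit
  interval\<close>

lemma dist_nint_le: "dist_nint x \<le> \<bar>x - of_int m\<bar>"
  unfolding dist_nint_def by (rule cINF_lower) (auto intro!: bdd_belowI[of _ 0])

lemma pp_eval_bounds:
  assumes pp: "pseudo_poly d \<alpha> \<theta>" and x: "x \<ge> 1"
  shows "0 \<le> pp_eval d \<alpha> \<theta> x \<and> pp_eval d \<alpha> \<theta> x \<le> (\<Sum>i=1..d. \<alpha> i) * x powr \<theta> d"
proof
  have \<alpha>: "\<alpha> i > 0" if "i \<in> {1..d}" for i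
    using pp that by (auto simp: pseudo_poly_def)
  then show "0 \<le> pp_eval d \<alpha> \<theta> x"
    unfolding pp_eval_def by (intro sum_nonneg mult_nonneg_nonneg) (auto intro: less_imp_le)
  show "pp_eval d \<alpha> \<theta> x \<le> (\<Sum>i=1..d. \<alpha> i) * x powr \<theta> d"
    unfolding pp_eval_def sum_distrib_right 
    using \<alpha> x pseudo_poly_exponent_le_top[OF pp]
    by (intro sum_mono mult_left_mono powr_mono) (auto intro: less_imp_le)
qed

theorem theorem2p6:
  fixes d :: nat and \<alpha> \<theta> :: "nat \<Rightarrow> real"
  assumes "pseudo_poly d \<alpha> \<theta>"
  shows "\<exists>\<eta>>0. \<exists>C>0. \<forall>\<xi>::real. \<forall>\<^sub>F N in sequentially.
           (MIN n\<in>{1..N}. dist_nint (\<xi> * of_int \<lfloor>pp_eval d \<alpha> \<theta> (real n)\<rfloor>))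
             \<le> C * real N powr (-\<eta>)"
proof -
  obtain s \<kappa> where s: "0 < s" "s < 1" and \<kappa>: "0 < \<kappa>"
    and expsum: "\<forall>\<^sub>F N in sequentially. \<forall>\<beta>. real N powr (- s) \<le> \<bar>\<beta>\<bar> \<longrightarrow> \<bar>\<beta>\<bar> \<le> real N powr s \<longrightarrow>
      norm (\<Sum>n=N..<2*N. ee (\<beta> * pp_eval d \<alpha> \<theta> (real n))) \<le> real N powr (1 - \<kappa>)"
    using pp_exp_sum_power_saving[OF assms] by blast
  have "(\<Sum>i=1..d. \<alpha> i) > 0"
    using assms by (intro sum_pos) (auto simp: pseudo_poly_def)
  moreover have "\<theta> d \<ge> 1"
    using assms by (intro pseudo_poly_exponent_ge_1) (auto simp: pseudo_poly_def)
  ultimately obtain \<eta> where \<eta>: "\<eta> > 0" and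
    near: "\<forall>\<^sub>F N in sequentially. \<forall>\<xi>. 0 \<le> \<xi> \<longrightarrow> \<xi> \<le> 1 \<longrightarrow>
      (\<exists>n\<in>{1..N}. \<exists>m::int. \<bar>\<xi> * of_int \<lfloor>pp_eval d \<alpha> \<theta> (real n)\<rfloor> - of_int m\<bar> \<le> real N powr (- \<eta>))"
    using eventually_ex_near_int_floor[OF s \<kappa> expsum _ _ pp_eval_bounds[OF assms]] by blast
  have "\<forall>\<^sub>F N in sequentially.
      (MIN n\<in>{1..N}. dist_nint (\<xi> * of_int \<lfloor>pp_eval d \<alpha> \<theta> (real n)\<rfloor>)) \<le> 1 * real N powr (-\<eta>)" for \<xi>
    using near
  proof eventually_elim
    case (elim N)
    \<comment> \<open>Replacing \<open>\<xi>\<close> by its fractional part changes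
      \<open>\<xi> * v\<close> by the integer \<open>\<lfloor>\<xi>\<rfloor> * v\<close>. As
      \<open>near\<close> is uniform over the unit interval, the threshold for \<open>N\<close> does
      not depend on \<open>\<xi>\<close>.\<close>
    have "0 \<le> frac \<xi>" "frac \<xi> \<le> 1" by (auto simp: frac_lt_1 less_imp_le)
    then obtain n and m :: int where n: "n \<in> {1..N}" and
      m: "\<bar>frac \<xi> * of_int \<lfloor>pp_eval d \<alpha> \<theta> (real n)\<rfloor> - of_int m\<bar> \<le> real N powr (- \<eta>)"
      using elim by blast
    define v where "v = \<lfloor>pp_eval d \<alpha> \<theta> (real n)\<rfloor>"
    have "(MIN n\<in>{1..N}. dist_nint (\<xi> * of_int \<lfloor>pp_eval d \<alpha> \<theta> (real n)\<rfloor>)) \<le> dist_nint (\<xi> * of_int v)"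
      unfolding v_def using n by (intro Min_le) auto
    also have "\<dots> \<le> \<bar>\<xi> * of_int v - of_int (m + \<lfloor>\<xi>\<rfloor> * v)\<bar>"
      by (rule dist_nint_le)
    also have "\<xi> * of_int v - of_int (m + \<lfloor>\<xi>\<rfloor> * v) = frac \<xi> * of_int v - of_int m"
      by (simp add: frac_def algebra_simps)
    finally show ?case using m by (simp add: v_def)
  qed
  then show ?thesis using \<eta> by (intro exI[of _ \<eta>] conjI exI[of _ 1]) auto
qed

end
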